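(* Suppose $f(t)=\sum_{k=1}^Kf_k(t)$, where $f_k(t)=\alpha_k(t)s_k(2\pi N_k\phi_k(t))$ is a GIMT of type $(M,N_k)$ with $N_k\ge N$, and the phase functions $\{\phi_k(t)\}_{1\le k\le K}$ are well-different of type $(M,K)$ at $b$. Let $s_0=\max_{(k,n)}|\widehat{s_k}(n)|$. Define $$h_k(t)=\frac{f\circ\phi_k^{-1}(t)}{\alpha_k\circ\phi_k^{-1}(t)}\qquad\text{for }1\le k\le K.$$ For fixed $M$, $K$, $b$, $s_0$ and $\delta>0$, there exists $T_0(M,K,s_0,\delta,b)$ such that for every $T>T_0$ there exists $N_0(M,K,s_0,T,b)>0$ such that for every $N>N_0$ the solution of the optimization problem $$(a_0,k_0)=\underset{(a,k)}{\arg\max}\ |\mathcal F_T(h_k)(a,b)|$$ satisfies $|a_0-nN_{k_0}|<\delta$ for some $n$ such that $\widehat{s_{k_0}}(n)\neq0$.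
   Context: For a $2\pi$-periodic function $\sigma$, $\widehat{\sigma}(n)$ ($n\in\mathbb Z$) are its Fourier coefficients, $\sigma(t)=\sum_n\widehat{\sigma}(n)e^{int}$. Shape functions: $\mathcal S_M$ consists of the $2\pi$-periodic functions $\sigma$ in the Wiener algebra with unit $L^2([-\pi,\pi])$-norm and $L^\infty$-norm bounded by $M$ such that (1) the Fourier series of $\sigma$ is uniformly convergent; (2) $\sum_{n}|\widehat\sigma(n)|\le M$ and $\widehat\sigma(0)=0$; (3) the greatest common divisor of the elements of $\{|n|:\widehat\sigma(n)\ne0\}$ is $1$. A function $\alpha(t)\sigma(2\pi N\phi(t))$ is a general intrinsic mode type function (GIMT) of type $(M,N)$ if $\sigma\in\mathcal S_M$, $\alpha\in C^\infty$, $|\alpha'|\le M$, $1/M\le\alpha\le M$, and $\phi\in C^\infty$, $1/M\le|\phi'|\le M$, $|\phi''|\le M$. Short-time Fourier transform: $w_1$ is a fixed real-valued, non-negative, smooth window function compactly supported in $(-1,1)$ such that $|\widehat{w_1}|$ has a sheer peak around the origin and rapidly decays elsewhere. For a parameter $T>1$ put $w_T(t)=w_1(t/T)$ and $$\mathcal F_T(g)(a,b)=\int_{\mathbb R}g(t)w_T(t-b)e^{-2\pi iat}\,dt,\qquad a,b\in\mathbb R.$$ Well-different phases: for $M>0$ and $K>0$, the phase functions $\{\phi_k(t)\}_{1\le k\le K}$ are well-different of type $(M,K)$ at $b\in\mathbb R$ if they satisfy the following conditions. (1) For any $T>0$, the number of extrema of $\phi_k\circ\phi_j^{-1}(t)$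 in $(b-T,b+T)$ is at most $TM$ for $k\ne j$. (2) For any $T>0$ there exist $\eta_0>0$, $\eta_1>0$ and $N_0(M,K,T,b)$ such that for all $a\in(\frac1{2M^2},2M^2)$ and all $N>N_0(M,K,T,b)$, $$\lambda^*\Big(\Big\{t:\big|\partial_t(\phi_k(\phi_j^{-1}(t)))-a\big|\le\tfrac1{N^{1-\eta_0}}\Big\}\cap\{t:b-T\le t\le b+T\}\Big)\lesssim O\Big(\frac{1}{N^{\eta_1}}\Big)\qquad\text{for }k\ne j,$$ where $\lambda^*$ denotes Lebesgue measure and $\lesssim$ means that the implicit constant may depend on $M$, $K$, $T$ and $b$.
   Formalization: Condition (2) of well-different phases is taken with the absolute value of the derivative of φ_k∘φ_j^{-1}; as written the claim fails for phases of opposite direction, e.g. φ_1(t)=t, φ_2(t)=-t with α_1=1, α_2=2. For phases all increasing nothing changes. *)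

theory Defs
  imports "HOL-Analysis.Analysis"
begin

definition smooth :: "(real \<Rightarrow> real) \<Rightarrow> bool" where
  "smooth f \<longleftrightarrow> (\<forall>n x. (deriv ^^ n) f differentiable (at x))"

definition fourier_coeff :: "(real \<Rightarrow> complex) \<Rightarrow> int \<Rightarrow> complex" where
  "fourier_coeff \<sigma> n = (1 / (2 * pi)) * (LBINT t:{-pi..pi}. \<sigma> t * cis (- (of_int n * t)))"

text \<open>The \<open>2\<pi>\<close>-periodic functions with an absolutely convergent Fourier series, taken in their
  continuous representative: \<open>has_sum\<close> is unconditional summation, which for complex
  numbers is absolute summation, and it is required to give the value at every point.\<close>

definition wiener_algebra :: "(real \<Rightarrow> complex) set" where
  "wiener_algebra = {\<sigma>. (\<forall>t. \<sigma> (t + 2 * pi) = \<sigma> t) \<and>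
     (\<lambda>n. cmod (fourier_coeff \<sigma> n)) summable_on UNIV \<and>
     (\<forall>t. ((\<lambda>n. fourier_coeff \<sigma> n * cis (of_int n * t)) has_sum \<sigma> t) UNIV)}"

definition shape_functions :: "real \<Rightarrow> (real \<Rightarrow> complex) set" where
  "shape_functions M = {\<sigma> \<in> wiener_algebra.
     set_integrable lborel {-pi..pi} (\<lambda>t. (cmod (\<sigma> t))\<^sup>2) \<and>
     sqrt (LBINT t:{-pi..pi}. (cmod (\<sigma> t))\<^sup>2) = 1 \<and>
     (AE t in lborel. cmod (\<sigma> t) \<le> M) \<and>
     uniform_limit UNIV
       (\<lambda>m t. \<Sum>n\<in>{- int m..int m}. fourier_coeff \<sigma> n * cis (of_int n * t)) \<sigma> sequentially \<and>
     (\<Sum>\<^sub>\<infinity>n. cmod (fourier_coeff \<sigma> n)) \<le> M \<and> fourier_coeff \<sigma> 0 = 0 \<and>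
     Gcd {\<bar>n\<bar> |n. fourier_coeff \<sigma> n \<noteq> 0} = 1}"

definition is_gimt :: "real \<Rightarrow> real \<Rightarrow> (real \<Rightarrow> real) \<Rightarrow> (real \<Rightarrow> complex) \<Rightarrow>
    (real \<Rightarrow> real) \<Rightarrow> (real \<Rightarrow> complex) \<Rightarrow> bool" where
  "is_gimt M N \<alpha> \<sigma> \<phi> g \<longleftrightarrow>
     (\<forall>t. g t = of_real (\<alpha> t) * \<sigma> (2 * pi * N * \<phi> t)) \<and>
     \<sigma> \<in> shape_functions M \<and>
     smooth \<alpha> \<and> (\<forall>t. \<bar>deriv \<alpha> t\<bar> \<le> M \<and> 1 / M \<le> \<alpha> t \<and> \<alpha> t \<le> M) \<and>
     smooth \<phi> \<and> (\<forall>t. 1 / M \<le> \<bar>deriv \<phi> t\<bar> \<and> \<bar>deriv \<phi> t\<bar> \<le> M \<and> \<bar>deriv (deriv \<phi>) t\<bar> \<le> M)"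

definition fourier_transform :: "(real \<Rightarrow> real) \<Rightarrow> real \<Rightarrow> complex" where
  "fourier_transform w \<xi> = (LBINT t. of_real (w t) * cis (- (2 * pi * \<xi> * t)))"

text \<open>The last two conditions render ``a sheer peak around the origin'' and ``rapid decay
  elsewhere''. They hold for every non-negative, not identically vanishing smooth function of
  compact support; the strict inequality also rules out the zero function.\<close>

definition window :: "(real \<Rightarrow> real) \<Rightarrow> bool" where
  "window w \<longleftrightarrow> smooth w \<and> (\<forall>t. 0 \<le> w t) \<and> closure {t. w t \<noteq> 0} \<subseteq> {-1<..<1} \<and>
     (\<forall>\<xi>. \<xi> \<noteq> 0 \<longrightarrow> cmod (fourier_transform w \<xi>) < cmod (fourier_transform w 0)) \<and>
     (\<forall>m. \<exists>B. \<forall>\<xi>. \<bar>\<xi>\<bar> ^ m * cmod (fourier_transform w \<xi>) \<le> B)"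

definition stft :: "(real \<Rightarrow> real) \<Rightarrow> real \<Rightarrow> (real \<Rightarrow> complex) \<Rightarrow> real \<Rightarrow> real \<Rightarrow> complex" where
  "stft w T g a b = (LBINT t. g t * of_real (w ((t - b) / T)) * cis (- (2 * pi * a * t)))"

definition local_extremum :: "(real \<Rightarrow> real) \<Rightarrow> real \<Rightarrow> bool" where
  "local_extremum f t \<longleftrightarrow> (\<forall>\<^sub>F u in nhds t. f u \<le> f t) \<or> (\<forall>\<^sub>F u in nhds t. f t \<le> f u)"

text \<open>The quantities \<open>\<eta>\<^sub>0, \<eta>\<^sub>1, N\<^sub>0\<close> and the implicit constant \<open>C\<close> of the measure estimate are
  functions of \<open>T\<close> and explicit parameters, because they must depend only on
  \<open>M, K, T, b\<close> and not on the phases.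

  The estimate uses the absolute value of the derivative of \<open>\<phi>\<^sub>k \<circ> \<phi>\<^sub>j\<^sup>-\<^sup>1\<close>. For phases that are
  monotone in the same direction this derivative is positive and the absolute value changes
  nothing. For phases of opposite direction, the estimate without it would say nothing (the
  derivative is negative and \<open>a\<close> is positive), and \<open>\<phi>\<^sub>1 t = t\<close>, \<open>\<phi>\<^sub>2 t = - t\<close> would be
  well-different.\<close>

definition well_different :: "(real \<Rightarrow> real) \<Rightarrow> (real \<Rightarrow> real) \<Rightarrow> (real \<Rightarrow> real) \<Rightarrow> (real \<Rightarrow> real) \<Rightarrow>
    real \<Rightarrow> nat \<Rightarrow> (nat \<Rightarrow> real \<Rightarrow> real) \<Rightarrow> real \<Rightarrow> bool" where
  "well_different \<eta>\<^sub>0 \<eta>\<^sub>1 N\<^sub>0 C M K \<phi> b \<longleftrightarrow>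
     (\<forall>T>0. \<forall>k\<in>{1..K}. \<forall>j\<in>{1..K}. k \<noteq> j \<longrightarrow>
        finite {t \<in> {b - T<..<b + T}. local_extremum (\<phi> k \<circ> inv (\<phi> j)) t} \<and>
        real (card {t \<in> {b - T<..<b + T}. local_extremum (\<phi> k \<circ> inv (\<phi> j)) t}) \<le> T * M) \<and>
     (\<forall>T>0. \<eta>\<^sub>0 T > 0 \<and> \<eta>\<^sub>1 T > 0 \<and> N\<^sub>0 T > 0 \<and>
        (\<forall>a\<in>{1 / (2 * M\<^sup>2)<..<2 * M\<^sup>2}. \<forall>N>N\<^sub>0 T. \<forall>k\<in>{1..K}. \<forall>j\<in>{1..K}. k \<noteq> j \<longrightarrow>
           measure lebesgue
             ({t. \<bar>\<bar>deriv (\<phi> k \<circ> inv (\<phi> j)) t\<bar> - a\<bar> \<le> 1 / N powr (1 - \<eta>\<^sub>0 T)} \<inter> {b - T..b + T})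
           \<le> C T * (1 / N powr \<eta>\<^sub>1 T)))"

definition is_max_coeff :: "nat \<Rightarrow> (nat \<Rightarrow> real \<Rightarrow> complex) \<Rightarrow> real \<Rightarrow> bool" where
  "is_max_coeff K s s\<^sub>0 \<longleftrightarrow>
     (\<exists>k\<in>{1..K}. \<exists>n. cmod (fourier_coeff (s k) n) = s\<^sub>0) \<and>
     (\<forall>k\<in>{1..K}. \<forall>n. cmod (fourier_coeff (s k) n) \<le> s\<^sub>0)"

definition warped :: "(real \<Rightarrow> complex) \<Rightarrow> (real \<Rightarrow> real) \<Rightarrow> (real \<Rightarrow> real) \<Rightarrow> real \<Rightarrow> complex" where
  "warped f \<alpha> \<phi> t = f (inv \<phi> t) / of_real (\<alpha> (inv \<phi> t))"

definition stft_solution :: "(real \<Rightarrow> real) \<Rightarrow> real \<Rightarrow> real \<Rightarrow> nat \<Rightarrow> (nat \<Rightarrow> real \<Rightarrow> complex) \<Rightarrow>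
    real \<times> nat \<Rightarrow> bool" where
  "stft_solution w T b K h =
     is_arg_max (\<lambda>(a, k). cmod (stft w T (h k) a b)) (\<lambda>(a, k). k \<in> {1..K})"

end

theory Submission
  imports Defs
begin

text \<open>
  Division by \<open>\<alpha>\<^sub>k\<close> and the change of variable \<open>t = \<phi>\<^sub>k u\<close> turn the \<open>k\<close>-th component of \<open>f\<close> into
  the exactly periodic function \<open>s\<^sub>k (2 \<pi> N\<^sub>k t)\<close>. Its contribution to the transform is therefore
  a superposition of translated copies of the window spectrum, one at each harmonic \<open>n N\<^sub>k\<close>, with
  weights \<open>T c\<^sub>n\<close>. Harmonics are \<open>N\<^sub>k\<close> apart, so for large \<open>N\<close> only the nearest one is felt
  (\<open>stft_near_single_harmonic\<close>). The other components remain frequency modulated after the warp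
  and contribute \<open>o(1)\<close> as \<open>N\<close> grows, uniformly in the frequency \<open>a\<close>
  (\<open>cross_integral_uniformly_small\<close>).

  Hence, with \<open>W = |w^(0)|\<close>, the maximum is at least \<open>(7/8) T s\<^sub>0 W\<close>, as the value at the harmonic
  carrying the largest coefficient shows; and a frequency that is \<open>\<delta>\<close>-far from all active harmonics
  only reaches \<open>T s\<^sub>0 |w^(T x)|\<close> with \<open>|x| \<ge> \<delta>\<close>, plus an eighth of \<open>T s\<^sub>0 W\<close>. The decay
  \<open>|\<xi>| |w^(\<xi>)| \<le> B\<close> makes this at most \<open>(5/8) T s\<^sub>0 W\<close> as soon as \<open>T > 2 B / (W \<delta>)\<close>. This
  threshold carries all the dependence on \<open>\<delta>\<close>, which is why the bound on \<open>N\<close> can be chosen before \<open>\<delta>\<close>.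
  Existence of a maximiser is a compactness argument based on the Riemann-Lebesgue lemma.

  The heart is the estimate of the cross terms. They are oscillatory integrals with phase derivative
  \<open>\<Lambda> (\<psi>' - c)\<close>, where \<open>\<psi> = \<phi>\<^sub>j \<circ> \<phi>\<^sub>k\<^sup>-\<^sup>1\<close>, \<open>\<Lambda> = n N\<^sub>j\<close> and \<open>c = a / \<Lambda>\<close> is arbitrary. The map
  \<open>\<psi>\<close> is strictly monotone, but \<open>\<psi>' - c\<close> may vanish and turn arbitrarily often, so cutting the
  integral into pieces where it is monotone gives no bound.
  Instead the amplitude is split smoothly by the weights \<open>u\<^sup>2 / (u\<^sup>2 + \<rho>\<^sup>2)\<close> and
  \<open>\<rho>\<^sup>2 / (u\<^sup>2 + \<rho>\<^sup>2)\<close>, where \<open>u = \<psi>' - c\<close>: the first part is integrated by parts and is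
  \<open>O(1 / \<Lambda>)\<close> for fixed \<open>\<rho>\<close>; the second one lives where \<open>u\<close> is small, and that set has small
  measure by the hypothesis on the phases. The hypothesis is applied at one fixed large parameter, which
  gives a width \<open>\<epsilon>\<close> that works for all phases and all \<open>c\<close>; then \<open>\<rho>\<close> is fixed, and then \<open>\<Lambda>\<close>
  is sent to infinity.
\<close>

section \<open>Phases, their inverses and transition maps\<close>

lemma smooth_has_deriv:
  assumes "smooth f"
  shows "(f has_real_derivative deriv f x) (at x)"
proof -
  have "(deriv ^^ 0) f differentiable (at x)"
    using assms unfolding smooth_def by blast
  then show ?thesis by (simp add: DERIV_deriv_iff_real_differentiable)
qed

lemma smooth_deriv:
  assumes "smooth f"
  shows "smooth (deriv f)"
proof -
  have "(deriv ^^ n) (deriv f) = (deriv ^^ Suc n) f" for n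
    by (simp add: funpow_Suc_right del: funpow.simps)
  then show ?thesis using assms unfolding smooth_def by metis
qed

lemma smooth_continuous:
  assumes "smooth f"
  shows "continuous_on S f"
  by (meson DERIV_isCont assms continuous_at_imp_continuous_on smooth_has_deriv)

text \<open>The regularity shared by the amplitudes and by the derivatives of the phases, so that
  both the quotients \<open>\<alpha>\<^sub>j / \<alpha>\<^sub>k\<close> and the derivatives of \<open>\<phi>\<^sub>j \<circ> \<phi>\<^sub>k\<^sup>-\<^sup>1\<close> are quotients of tame functions,
  taken along \<open>\<phi>\<^sub>k\<^sup>-\<^sup>1\<close>.\<close>

definition tame :: "real \<Rightarrow> (real \<Rightarrow> real) \<Rightarrow> bool" where
  "tame M q \<longleftrightarrow> smooth q \<and> (\<forall>t. 1 / M \<le> \<bar>q t\<bar> \<and> \<bar>q t\<bar> \<le> M \<and> \<bar>deriv q t\<bar> \<le> M)"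

lemma tame_nonzero: "tame M q \<Longrightarrow> M > 0 \<Longrightarrow> q t \<noteq> 0"
  unfolding tame_def by (metis abs_zero divide_pos_pos less_numeral_extra(1) linorder_not_less)

text \<open>The mean value theorem; it makes the phase injective and its inverse Lipschitz.\<close>

lemma phase_expands:
  assumes "smooth \<phi>" "tame M (deriv \<phi>)" "M > 0"
  shows "\<bar>x - y\<bar> \<le> M * \<bar>\<phi> x - \<phi> y\<bar>"
proof -
  have *: "y - x \<le> M * \<bar>\<phi> x - \<phi> y\<bar>" if "x < y" for x y
  proof -
    have "\<exists>z>x. z < y \<and> \<phi> y - \<phi> x = (y - x) * deriv \<phi> z"
      using that smooth_has_deriv[OF assms(1)] by (intro MVT2) auto
    then obtain z where z: "\<phi> y - \<phi> x = (y - x) * deriv \<phi> z"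
      by blast
    have "1 / M \<le> \<bar>deriv \<phi> z\<bar>" using assms(2) unfolding tame_def by blast
    then have "1 \<le> M * \<bar>deriv \<phi> z\<bar>" using assms(3) by (simp add: field_simps)
    then have "(y - x) * 1 \<le> (y - x) * (M * \<bar>deriv \<phi> z\<bar>)"
      using that by (intro mult_left_mono) auto
    also have "\<dots> = M * \<bar>\<phi> x - \<phi> y\<bar>"
      using z that abs_minus_commute[of "\<phi> x" "\<phi> y"] by (simp add: abs_mult)
    finally show ?thesis by simp
  qed
  show ?thesis
    using *[of x y] *[of y x] assms(3)
    by (cases x y rule: linorder_cases) (auto simp: abs_minus_commute)
qed

text \<open>A continuous injection of the line is monotone, and the expansion estimate drives it to
  infinity on both sides, so the intermediate value theorem gives surjectivity.\<close>

lemma phase_bij: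
  assumes "smooth \<phi>" "tame M (deriv \<phi>)" "M > 0"
  shows "bij \<phi>"
proof (rule bijI)
  have far: "\<bar>x - y\<bar> \<le> M * \<bar>\<phi> x - \<phi> y\<bar>" for x y
    using phase_expands[OF assms] .
  show inj: "inj \<phi>"
  proof (rule injI)
    fix x y assume "\<phi> x = \<phi> y"
    then show "x = y" using far[of x y] by simp
  qed
  show "surj \<phi>"
  proof (rule surjI[where f="\<lambda>y. inv \<phi> y"])
    fix y
    define R where "R = M * \<bar>y - \<phi> 0\<bar> + 1"
    have R: "R > 0" unfolding R_def using assms(3) by (simp add: add_nonneg_pos)
    have cont: "continuous_on S \<phi>" for S
      using smooth_continuous[OF assms(1)] .
    \<comment> \<open>At the points \<open>- R\<close> and \<open>R\<close> the phase has moved past \<open>y\<close>.\<close>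
    have out: "\<bar>y - \<phi> 0\<bar> \<le> \<bar>\<phi> x - \<phi> 0\<bar>" if "\<bar>x\<bar> = R" for x
    proof -
      have "M * \<bar>y - \<phi> 0\<bar> \<le> M * \<bar>\<phi> x - \<phi> 0\<bar>"
        using far[of x 0] that unfolding R_def by simp
      then show ?thesis using assms(3) by simp
    qed
    have mono: "(\<phi> (-R) < \<phi> 0 \<and> \<phi> 0 < \<phi> R) \<or> (\<phi> R < \<phi> 0 \<and> \<phi> 0 < \<phi> (-R))"
      using continuous_inj_imp_mono[of "-R" 0 R \<phi>] R cont inj_on_subset[OF inj] by auto
    then have "\<exists>x. \<phi> x = y"
    proof
      assume *: "\<phi> (-R) < \<phi> 0 \<and> \<phi> 0 < \<phi> R"
      then have "\<phi> (-R) \<le> y" "y \<le> \<phi> R" using out[of R] out[of "-R"] R by auto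
      then show ?thesis using IVT'[of \<phi> "-R" y R] R cont by force
    next
      assume *: "\<phi> R < \<phi> 0 \<and> \<phi> 0 < \<phi> (-R)"
      then have "\<phi> R \<le> y" "y \<le> \<phi> (-R)" using out[of R] out[of "-R"] R by auto
      then show ?thesis using IVT2'[of \<phi> R y "-R"] R cont by force
    qed
    then show "\<phi> (inv \<phi> y) = y" by (meson f_inv_into_f rangeI)
  qed
qed

lemma inv_phase_has_deriv:
  assumes "smooth \<phi>" "tame M (deriv \<phi>)" "M > 0"
  shows "(inv \<phi> has_real_derivative 1 / deriv \<phi> (inv \<phi> t)) (at t)"
proof -
  have surj: "\<phi> (inv \<phi> y) = y" for y
    using phase_bij[OF assms] by (simp add: bij_is_surj surj_f_inv_f)
  have lip: "\<bar>inv \<phi> x - inv \<phi> y\<bar> \<le> M * \<bar>x - y\<bar>" for x y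
    using phase_expands[OF assms, of "inv \<phi> x" "inv \<phi> y"] by (simp add: surj)
  have "M-lipschitz_on UNIV (inv \<phi>)"
    using lip assms(3) by (intro lipschitz_onI) (auto simp: dist_real_def)
  then have "isCont (inv \<phi>) t"
    using lipschitz_on_continuous_on continuous_on_eq_continuous_at by blast
  then have "(inv \<phi> has_real_derivative inverse (deriv \<phi> (inv \<phi> t))) (at t)"
    using tame_nonzero[OF assms(2,3)] surj smooth_has_deriv[OF assms(1)]
    by (intro DERIV_inverse_function[where f=\<phi> and a="t-1" and b="t+1"]) auto
  then show ?thesis by (simp add: inverse_eq_divide)
qed

text \<open>One computation serves twice: for amplitudes it bounds the derivative of the warped
  amplitude, for derivatives of phases it bounds the second derivative of a transition map. The
  constant is \<open>2 M\<^sup>2\<close> for the numerator of the quotient rule and a factor \<open>M\<close> for each of the three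
  divisions.\<close>

lemma tame_quotient_along_inverse:
  assumes p: "tame M p" and q: "tame M q" and \<phi>: "smooth \<phi>" "tame M (deriv \<phi>)" and M: "M > 0"
  obtains Q' where "continuous_on UNIV Q'"
    "\<And>t. ((\<lambda>t. p (inv \<phi> t) / q (inv \<phi> t)) has_real_derivative Q' t) (at t)"
    "\<And>t. \<bar>Q' t\<bar> \<le> 2 * M ^ 5"
proof -
  let ?X = "inv \<phi>"
  define Q' where "Q' = (\<lambda>t. (deriv p (?X t) * q (?X t) - p (?X t) * deriv q (?X t))
      / (q (?X t))\<^sup>2 * (1 / deriv \<phi> (?X t)))"
  have contX: "continuous_on UNIV ?X"
    by (meson DERIV_isCont continuous_at_imp_continuous_on inv_phase_has_deriv[OF \<phi> M])
  have cX: "continuous_on UNIV (\<lambda>t. f (?X t))" if "smooth f" for f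
    using continuous_on_compose2[OF smooth_continuous[OF that, of UNIV] contX] by simp
  have sm: "smooth p" "smooth q" using p q unfolding tame_def by auto
  have "continuous_on UNIV Q'"
    unfolding Q'_def
    using tame_nonzero[OF q M] tame_nonzero[OF \<phi>(2) M] \<phi>(1) sm
    by (intro continuous_intros cX smooth_deriv) auto
  moreover have "((\<lambda>t. p (?X t) / q (?X t)) has_real_derivative Q' t) (at t)" for t
  proof -
    have d: "((\<lambda>t. f (?X t)) has_real_derivative deriv f (?X t) * (1 / deriv \<phi> (?X t))) (at t)"
      if "smooth f" for f
      using DERIV_chain2[OF smooth_has_deriv[OF that] inv_phase_has_deriv[OF \<phi> M]] .
    show ?thesis
      using DERIV_divide[OF d[OF sm(1)] d[OF sm(2)] tame_nonzero[OF q M, of "?X t"]]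
        tame_nonzero[OF q M, of "?X t"] tame_nonzero[OF \<phi>(2) M, of "?X t"]
      unfolding Q'_def by (simp add: power2_eq_square divide_simps mult_ac)
  qed
  moreover have "\<bar>Q' t\<bar> \<le> 2 * M ^ 5" for t
  proof -
    let ?x = "?X t"
    have inv: "1 / \<bar>r x\<bar> \<le> M" if "tame M r" for r x
    proof -
      have "1 / M \<le> \<bar>r x\<bar>" using that unfolding tame_def by blast
      then show ?thesis using M tame_nonzero[OF that M, of x] by (simp add: field_simps)
    qed
    have "\<bar>deriv p ?x * q ?x\<bar> \<le> M * M" "\<bar>p ?x * deriv q ?x\<bar> \<le> M * M"
      unfolding abs_mult using p q M unfolding tame_def by (auto intro!: mult_mono)
    then have num: "\<bar>deriv p ?x * q ?x - p ?x * deriv q ?x\<bar> \<le> 2 * M\<^sup>2"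
      by (simp add: power2_eq_square)
    have "\<bar>Q' t\<bar> = \<bar>deriv p ?x * q ?x - p ?x * deriv q ?x\<bar> * (1 / \<bar>q ?x\<bar>) * (1 / \<bar>q ?x\<bar>)
        * (1 / \<bar>deriv \<phi> ?x\<bar>)"
      unfolding Q'_def by (simp add: abs_mult power2_eq_square)
    also have "\<dots> \<le> (2 * M\<^sup>2) * M * M * M"
      using num inv[OF q] inv[OF \<phi>(2)] M by (intro mult_mono) auto
    also have "\<dots> = 2 * M ^ 5" by (simp add: power2_eq_square power_numeral_reduce)
    finally show ?thesis .
  qed
  ultimately show ?thesis using that by blast
qed

lemma tame_quotient_bounds:
  assumes p: "tame M p" and q: "tame M q" and M: "M > 0"
  shows "1 / M\<^sup>2 \<le> \<bar>p x / q y\<bar>" "\<bar>p x / q y\<bar> \<le> M\<^sup>2"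
proof -
  have q0: "\<bar>q y\<bar> > 0" using tame_nonzero[OF q M, of y] by simp
  have b: "1 / M \<le> \<bar>p x\<bar>" "\<bar>p x\<bar> \<le> M" "1 / M \<le> \<bar>q y\<bar>" "\<bar>q y\<bar> \<le> M"
    using p q unfolding tame_def by auto
  have "\<bar>q y\<bar> / M\<^sup>2 \<le> M / M\<^sup>2" using b by (intro divide_right_mono) auto
  also have "\<dots> = 1 / M" using M by (simp add: power2_eq_square)
  also have "\<dots> \<le> \<bar>p x\<bar>" using b by simp
  finally show "1 / M\<^sup>2 \<le> \<bar>p x / q y\<bar>" using q0 M by (simp add: divide_simps mult.commute)
  have "M = M\<^sup>2 * (1 / M)" using M by (simp add: power2_eq_square)
  also have "\<dots> \<le> M\<^sup>2 * \<bar>q y\<bar>" using b by (intro mult_left_mono) auto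
  finally show "\<bar>p x / q y\<bar> \<le> M\<^sup>2" using b q0 by (simp add: abs_divide field_simps)
qed

lemma transition_has_deriv:
  assumes "smooth \<phi>" "tame M (deriv \<phi>)" "smooth \<psi>" "M > 0"
  shows "((\<psi> \<circ> inv \<phi>) has_real_derivative deriv \<psi> (inv \<phi> t) / deriv \<phi> (inv \<phi> t)) (at t)"
  using DERIV_chain2[OF smooth_has_deriv[OF assms(3)] inv_phase_has_deriv[OF assms(1,2,4)]]
  by (simp add: comp_def)

section \<open>Oscillatory integrals with few nearly stationary points\<close>

lemma cis_has_vector_derivative:
  assumes "(v has_real_derivative d) (at t)"
  shows "((\<lambda>t. cis (v t)) has_vector_derivative (of_real d * (\<i> * cis (v t)))) (at t)"
proof -
  have "((\<lambda>t. complex_of_real (v t)) has_vector_derivative of_real d) (at t)"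
    using assms by (rule has_vector_derivative_of_real)
  then have "((\<lambda>t. \<i> * complex_of_real (v t)) has_vector_derivative \<i> * of_real d) (at t)"
    by (rule has_vector_derivative_mult_right)
  then have "((exp \<circ> (\<lambda>t. \<i> * complex_of_real (v t))) has_vector_derivative
      (\<i> * of_real d) * exp (\<i> * complex_of_real (v t))) (at t)"
    by (rule field_vector_diff_chain_at) (rule DERIV_exp)
  then show ?thesis by (simp add: comp_def cis_conv_exp mult_ac)
qed

text \<open>A substitute for the van der Corput lemma that needs no monotonicity of the phase
  derivative \<open>u\<close>. The usual division by \<open>u\<close> is replaced by multiplication with
  \<open>G = u / (u\<^sup>2 + \<rho>\<^sup>2)\<close>, which stays smooth at zeros of \<open>u\<close> and satisfies
  \<open>|G| \<le> 1 / (2 \<rho>)\<close> and \<open>|G'| \<le> |u'| / \<rho>\<^sup>2\<close>. Since \<open>A = A G u + A \<rho>\<^sup>2 / (u\<^sup>2 + \<rho>\<^sup>2)\<close>, the first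
  part can be integrated by parts and the second one is bounded by absolute values.\<close>

lemma oscillatory_integral_bound:
  fixes A A' v u u' :: "real \<Rightarrow> real" and \<Lambda> \<rho> A\<^sub>0 A\<^sub>1 D p q :: real
  assumes pq: "p \<le> q" and ends: "A p = 0" "A q = 0"
    and dA: "\<And>t. (A has_real_derivative A' t) (at t)"
    and dv: "\<And>t. (v has_real_derivative u t) (at t)"
    and du: "\<And>t. (u has_real_derivative u' t) (at t)"
    and cont: "continuous_on UNIV A'" "continuous_on UNIV u'"
    and A\<^sub>0: "\<And>t. t \<in> {p..q} \<Longrightarrow> \<bar>A t\<bar> \<le> A\<^sub>0"
    and A\<^sub>1: "\<And>t. t \<in> {p..q} \<Longrightarrow> \<bar>A' t\<bar> \<le> A\<^sub>1"
    and D: "\<And>t. t \<in> {p..q} \<Longrightarrow> \<bar>u' t\<bar> \<le> D"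
    and \<rho>: "\<rho> > 0" and \<Lambda>: "\<Lambda> \<noteq> 0"
  shows "cmod (integral {p..q} (\<lambda>t. of_real (A t) * cis (\<Lambda> * v t)))
    \<le> A\<^sub>0 * integral {p..q} (\<lambda>t. \<rho>\<^sup>2 / ((u t)\<^sup>2 + \<rho>\<^sup>2))
      + (q - p) * (A\<^sub>1 / (2 * \<rho>) + A\<^sub>0 * D / \<rho>\<^sup>2) / \<bar>\<Lambda>\<bar>"
proof -
  have pos: "(u t)\<^sup>2 + \<rho>\<^sup>2 > 0" for t using \<rho> by (simp add: add_nonneg_pos)
  have nz: "(u t)\<^sup>2 + \<rho>\<^sup>2 \<noteq> 0" for t by (metis less_irrefl pos)
  have cA: "continuous_on S A" and cv: "continuous_on S v" and cu: "continuous_on S u" for S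
    by (meson DERIV_isCont continuous_at_imp_continuous_on dA dv du)+
  have cA': "continuous_on S A'" and cu': "continuous_on S u'" for S
    using cont continuous_on_subset by blast+
  have ccis: "continuous_on S (\<lambda>t. cis (\<Lambda> * v t))" for S
    unfolding cis_conv_exp by (intro continuous_intros cv)
  define G where "G = (\<lambda>t. u t / ((u t)\<^sup>2 + \<rho>\<^sup>2))"
  define G' where "G' = (\<lambda>t. u' t * (\<rho>\<^sup>2 - (u t)\<^sup>2) / ((u t)\<^sup>2 + \<rho>\<^sup>2)\<^sup>2)"
  have dG: "(G has_real_derivative G' t) (at t)" for t
    unfolding G_def G'_def
    by (rule derivative_eq_intros du refl nz)+ (simp add: power2_eq_square algebra_simps)
  have cG: "continuous_on S G" "continuous_on S G'" for S
    unfolding G_def G'_def using nz by (intro continuous_intros cu cu'; simp)+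
  have Gb: "\<bar>G t\<bar> \<le> 1 / (2 * \<rho>)" for t
  proof -
    have "0 \<le> (\<bar>u t\<bar> - \<rho>)\<^sup>2" by simp
    then have "\<bar>u t\<bar> * (2 * \<rho>) \<le> (u t)\<^sup>2 + \<rho>\<^sup>2" by (simp add: power2_diff mult_ac)
    then show ?thesis unfolding G_def using pos[of t] \<rho> by (simp add: abs_divide field_simps)
  qed
  have G'b: "\<bar>G' t\<bar> \<le> D / \<rho>\<^sup>2" if "t \<in> {p..q}" for t
  proof -
    have D0: "0 \<le> D" using D[OF that] by linarith
    have "\<bar>G' t\<bar> = \<bar>u' t\<bar> * (\<bar>\<rho>\<^sup>2 - (u t)\<^sup>2\<bar> / ((u t)\<^sup>2 + \<rho>\<^sup>2)) * (1 / ((u t)\<^sup>2 + \<rho>\<^sup>2))"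
      unfolding G'_def by (simp add: abs_mult power2_eq_square[of "_ + _"])
    also have "\<dots> \<le> D * 1 * (1 / \<rho>\<^sup>2)"
    proof (intro mult_mono)
      show "\<bar>\<rho>\<^sup>2 - (u t)\<^sup>2\<bar> / ((u t)\<^sup>2 + \<rho>\<^sup>2) \<le> 1"
        using pos[of t] by (simp add: abs_le_iff)
      show "1 / ((u t)\<^sup>2 + \<rho>\<^sup>2) \<le> 1 / \<rho>\<^sup>2" using \<rho> by (intro frac_le) auto
    qed (use D[OF that] D0 in auto)
    finally show ?thesis by simp
  qed
  let ?B = "\<lambda>t. of_real (A' t * G t + A t * G' t) * cis (\<Lambda> * v t)"
  let ?J = "\<lambda>t. of_real (A t * (G t * u t)) * cis (\<Lambda> * v t)"
  let ?R = "\<lambda>t. of_real (A t * (\<rho>\<^sup>2 / ((u t)\<^sup>2 + \<rho>\<^sup>2))) * cis (\<Lambda> * v t)"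
  have iB: "?B integrable_on {p..q}" and iJ: "?J integrable_on {p..q}"
    and iR: "?R integrable_on {p..q}"
    using nz by (intro integrable_continuous_real continuous_intros cA cA' cG ccis cu; simp)+
  \<comment> \<open>Up to the factor \<open>\<i> \<Lambda>\<close>, \<open>?J\<close> is a total derivative minus \<open>?B\<close>.\<close>
  have dF: "((\<lambda>t. of_real (A t * G t) * cis (\<Lambda> * v t)) has_vector_derivative
      ?B t + \<i> * of_real \<Lambda> * ?J t) (at t)" for t
  proof -
    have 1: "((\<lambda>t. complex_of_real (A t * G t)) has_vector_derivative
        of_real (A' t * G t + A t * G' t)) (at t)"
      using DERIV_mult[OF dA[of t] dG[of t]]
      by (intro has_vector_derivative_of_real)
        (simp add: has_real_derivative_iff_has_vector_derivative[symmetric] mult_ac add_ac)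
    have 2: "((\<lambda>t. cis (\<Lambda> * v t)) has_vector_derivative
        of_real (\<Lambda> * u t) * (\<i> * cis (\<Lambda> * v t))) (at t)"
      by (intro cis_has_vector_derivative DERIV_cmult dv)
    show ?thesis
      using has_vector_derivative_mult[OF 1 2] by (simp add: algebra_simps)
  qed
  have "((\<lambda>t. ?B t + \<i> * of_real \<Lambda> * ?J t) has_integral
      of_real (A q * G q) * cis (\<Lambda> * v q) - of_real (A p * G p) * cis (\<Lambda> * v p)) {p..q}"
    by (rule fundamental_theorem_of_calculus[OF pq has_vector_derivative_at_within[OF dF]])
  then have "integral {p..q} (\<lambda>t. ?B t + \<i> * of_real \<Lambda> * ?J t) = 0"
    using ends by (simp add: integral_unique)
  moreover have "integral {p..q} (\<lambda>t. ?B t + \<i> * of_real \<Lambda> * ?J t)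
      = integral {p..q} ?B + \<i> * of_real \<Lambda> * integral {p..q} ?J"
    using iB iJ by (subst integral_add) (auto intro: integrable_on_mult_right)
  ultimately have "integral {p..q} ?B = - (\<i> * of_real \<Lambda> * integral {p..q} ?J)"
    by (simp only: eq_neg_iff_add_eq_0)
  then have "cmod (integral {p..q} ?B) = \<bar>\<Lambda>\<bar> * cmod (integral {p..q} ?J)"
    by (simp add: norm_mult)
  moreover have "cmod (integral {p..q} ?B) \<le> (A\<^sub>1 / (2 * \<rho>) + A\<^sub>0 * D / \<rho>\<^sup>2) * (q - p)"
  proof (rule integral_bound[OF pq])
    show "continuous_on {p..q} ?B"
      by (intro continuous_intros cA cA' cG ccis)
    fix t assume t: "t \<in> {p..q}"
    have "\<bar>A' t * G t + A t * G' t\<bar> \<le> \<bar>A' t\<bar> * \<bar>G t\<bar> + \<bar>A t\<bar> * \<bar>G' t\<bar>"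
      by (metis abs_mult abs_triangle_ineq)
    also have "\<dots> \<le> A\<^sub>1 * (1 / (2 * \<rho>)) + A\<^sub>0 * (D / \<rho>\<^sup>2)"
      using A\<^sub>0[OF t] A\<^sub>1[OF t] Gb[of t] G'b[OF t]
      by (intro add_mono mult_mono) auto
    finally show "cmod (?B t) \<le> A\<^sub>1 / (2 * \<rho>) + A\<^sub>0 * D / \<rho>\<^sup>2" by (simp add: norm_mult del: of_real_add of_real_mult)
  qed
  ultimately have J: "cmod (integral {p..q} ?J) \<le> (q - p) * (A\<^sub>1 / (2 * \<rho>) + A\<^sub>0 * D / \<rho>\<^sup>2) / \<bar>\<Lambda>\<bar>"
    using \<Lambda> by (simp add: field_simps)
  have "cmod (integral {p..q} ?R) \<le> integral {p..q} (\<lambda>t. A\<^sub>0 * (\<rho>\<^sup>2 / ((u t)\<^sup>2 + \<rho>\<^sup>2)))"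
  proof (rule integral_norm_bound_integral[OF iR])
    show "(\<lambda>t. A\<^sub>0 * (\<rho>\<^sup>2 / ((u t)\<^sup>2 + \<rho>\<^sup>2))) integrable_on {p..q}"
      using nz by (intro integrable_continuous_real continuous_intros cu; simp)
    fix t assume "t \<in> {p..q}"
    then show "cmod (?R t) \<le> A\<^sub>0 * (\<rho>\<^sup>2 / ((u t)\<^sup>2 + \<rho>\<^sup>2))"
      using A\<^sub>0[of t] pos[of t] by (simp add: norm_mult norm_divide divide_right_mono mult_right_mono
          abs_mult abs_divide del: of_real_add of_real_mult of_real_divide)
  qed
  then have R: "cmod (integral {p..q} ?R) \<le> A\<^sub>0 * integral {p..q} (\<lambda>t. \<rho>\<^sup>2 / ((u t)\<^sup>2 + \<rho>\<^sup>2))"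
    by (simp only: integral_mult_right)
  have "A t = A t * (G t * u t) + A t * (\<rho>\<^sup>2 / ((u t)\<^sup>2 + \<rho>\<^sup>2))" for t
  proof -
    have "G t * u t + \<rho>\<^sup>2 / ((u t)\<^sup>2 + \<rho>\<^sup>2) = 1"
      unfolding G_def using nz[of t] by (simp add: power2_eq_square add_divide_distrib[symmetric])
    then show ?thesis by (metis distrib_left mult.right_neutral)
  qed
  then have "of_real (A t) * cis (\<Lambda> * v t) = ?J t + ?R t" for t
    by (metis (no_types) distrib_right of_real_add)
  then have "integral {p..q} (\<lambda>t. of_real (A t) * cis (\<Lambda> * v t))
      = integral {p..q} ?J + integral {p..q} ?R"
    using integral_add[OF iJ iR] by presburger
  moreover have "cmod x \<le> r + j" if "x = y + z" "cmod y \<le> j" "cmod z \<le> r" for x y z :: complex and r j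
    using norm_triangle_ineq[of y z] that by simp
  ultimately show ?thesis using J R by blast
qed

text \<open>Off the set where \<open>|u| \<le> \<epsilon>\<close> the integrand is at most \<open>\<rho>\<^sup>2 / \<epsilon>\<^sup>2\<close>, and on it at most 1.\<close>

lemma integral_near_zero_set_bound:
  fixes u :: "real \<Rightarrow> real"
  assumes pq: "p \<le> q" and cont: "continuous_on {p..q} u" and pos: "\<rho> > 0" "\<epsilon> > 0"
  shows "integral {p..q} (\<lambda>t. \<rho>\<^sup>2 / ((u t)\<^sup>2 + \<rho>\<^sup>2))
    \<le> measure lebesgue {t \<in> {p..q}. \<bar>u t\<bar> \<le> \<epsilon>} + (q - p) * (\<rho>\<^sup>2 / \<epsilon>\<^sup>2)"
proof -
  let ?E = "{t \<in> {p..q}. \<bar>u t\<bar> \<le> \<epsilon>}"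
  have nz: "(u t)\<^sup>2 + \<rho>\<^sup>2 > 0" for t using pos by (simp add: add_nonneg_pos)
  have "closed ?E"
    using continuous_closed_preimage[of "{p..q}" u "{-\<epsilon>..\<epsilon>}"] cont
    by (simp add: vimage_def Int_def abs_le_iff conj_commute minus_le_iff)
  then have "compact ?E"
    by (rule closed_Int_compact[OF _ compact_Icc[of p q], THEN back_subst[of compact]]) auto
  then have E: "?E \<in> lmeasurable" by (rule lmeasurable_compact)
  have EI: "?E \<inter> {p..q} = ?E" by auto
  have "integral {p..q} (\<lambda>t. \<rho>\<^sup>2 / ((u t)\<^sup>2 + \<rho>\<^sup>2))
      \<le> integral {p..q} (\<lambda>t. (if t \<in> ?E then 1 else 0) + \<rho>\<^sup>2 / \<epsilon>\<^sup>2)"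
  proof (rule integral_le)
    show "(\<lambda>t. \<rho>\<^sup>2 / ((u t)\<^sup>2 + \<rho>\<^sup>2)) integrable_on {p..q}"
      using nz by (intro integrable_continuous_real continuous_intros cont) (metis less_irrefl)
    show "(\<lambda>t. (if t \<in> ?E then 1 else 0) + \<rho>\<^sup>2 / \<epsilon>\<^sup>2) integrable_on {p..q}"
    proof (intro integrable_add)
      show "(\<lambda>t. if t \<in> ?E then 1 else 0 :: real) integrable_on {p..q}"
        using integrable_on_const[OF E, of "1::real"] EI by (simp only: integrable_restrict_Int)
    qed auto
    fix t assume t: "t \<in> {p..q}"
    show "\<rho>\<^sup>2 / ((u t)\<^sup>2 + \<rho>\<^sup>2) \<le> (if t \<in> ?E then 1 else 0) + \<rho>\<^sup>2 / \<epsilon>\<^sup>2"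
    proof (cases "\<bar>u t\<bar> \<le> \<epsilon>")
      case True
      have "\<rho>\<^sup>2 / ((u t)\<^sup>2 + \<rho>\<^sup>2) \<le> 1" using nz[of t] by simp
      then show ?thesis using True t by (simp add: add_increasing2)
    next
      case False
      then have "\<epsilon>\<^sup>2 \<le> (u t)\<^sup>2" using pos by (simp add: abs_le_square_iff[symmetric])
      then have "\<rho>\<^sup>2 / ((u t)\<^sup>2 + \<rho>\<^sup>2) \<le> \<rho>\<^sup>2 / \<epsilon>\<^sup>2"
        using pos nz[of t] by (intro divide_left_mono) (auto intro: add_increasing2)
      then show ?thesis using False by simp
    qed
  qed
  also have "\<dots> = integral {p..q} (\<lambda>t. if t \<in> ?E then 1 else 0) + (q - p) * (\<rho>\<^sup>2 / \<epsilon>\<^sup>2)"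
    using integrable_on_const[OF E, of "1::real"] pq EI
    by (subst integral_add) (simp_all only: Henstock_Kurzweil_Integration.integrable_restrict_Int, auto)
  also have "integral {p..q} (\<lambda>t. if t \<in> ?E then 1 else (0::real)) = integral ?E (\<lambda>_. 1)"
    using EI by (simp only: Henstock_Kurzweil_Integration.integral_restrict_Int)
  also have "\<dots> = measure lebesgue ?E" using lmeasure_integral[OF E] by simp
  finally show ?thesis by simp
qed

text \<open>The measure estimate for well-different phases only concerns \<open>|d|\<close> and levels \<open>a\<close> in a
  bounded interval, at shrinking widths. Used at a single value of \<open>N\<close>, chosen so large that the
  right-hand side is at most \<open>\<tau>\<close>, it yields one width \<open>\<epsilon>\<close> for every \<open>d\<close> and every real level
  \<open>c\<close>: levels with \<open>|c|\<close> outside the interval keep a distance of at least \<open>1 / (2 M\<^sup>2)\<close> from the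
  range of \<open>|d|\<close>.\<close>

lemma sublevel_sets_uniformly_small:
  fixes M \<eta>\<^sub>0 \<eta>\<^sub>1 N\<^sub>1 C \<tau> p q :: real
  assumes M: "M \<ge> 1" and \<eta>\<^sub>1: "\<eta>\<^sub>1 > 0" and \<tau>: "\<tau> > 0"
  obtains \<epsilon> where "\<epsilon> > 0"
    "\<And>(d :: real \<Rightarrow> real) c. \<lbrakk>continuous_on UNIV d; \<And>t. 1 / M\<^sup>2 \<le> \<bar>d t\<bar> \<and> \<bar>d t\<bar> \<le> M\<^sup>2;
        \<forall>a\<in>{1 / (2 * M\<^sup>2)<..<2 * M\<^sup>2}. \<forall>N>N\<^sub>1.
          measure lebesgue ({t. \<bar>\<bar>d t\<bar> - a\<bar> \<le> 1 / N powr (1 - \<eta>\<^sub>0)} \<inter> {p..q})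
            \<le> C * (1 / N powr \<eta>\<^sub>1)\<rbrakk>
      \<Longrightarrow> measure lebesgue {t \<in> {p..q}. \<bar>d t - c\<bar> \<le> \<epsilon>} \<le> \<tau>"
proof -
  define N where "N = \<bar>N\<^sub>1\<bar> + (\<bar>C\<bar> / \<tau>) powr (1 / \<eta>\<^sub>1) + 1"
  have N: "N > N\<^sub>1" "N > 0" unfolding N_def by (smt (verit) powr_ge_zero)+
  have "\<bar>C\<bar> / \<tau> = ((\<bar>C\<bar> / \<tau>) powr (1 / \<eta>\<^sub>1)) powr \<eta>\<^sub>1"
    using \<eta>\<^sub>1 \<tau> by (simp add: powr_powr)
  also have "\<dots> \<le> N powr \<eta>\<^sub>1" unfolding N_def using \<eta>\<^sub>1 by (intro powr_mono2) auto
  finally have CN: "\<bar>C\<bar> * (1 / N powr \<eta>\<^sub>1) \<le> \<tau>"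
    using \<tau> N by (simp add: field_simps)
  define m where "m = 1 / (4 * M\<^sup>2)"
  have M2: "M\<^sup>2 \<ge> 1" using M by simp
  have m: "0 < m" "m \<le> 1 / 4" "1 / M\<^sup>2 = 4 * m" "1 / (2 * M\<^sup>2) = 2 * m"
  proof -
    have "1 / M\<^sup>2 \<le> 1" using M2 by (subst divide_le_eq_1_pos) linarith+
    then show "m \<le> 1 / 4" unfolding m_def by simp
    show "0 < m" unfolding m_def using M by simp
  qed (auto simp: m_def)
  define \<epsilon> where "\<epsilon> = min (1 / N powr (1 - \<eta>\<^sub>0)) m"
  show ?thesis
  proof
    show "\<epsilon> > 0" unfolding \<epsilon>_def using N m by simp
    fix d :: "real \<Rightarrow> real" and c
    assume cont: "continuous_on UNIV d"
      and d: "\<And>t. 1 / M\<^sup>2 \<le> \<bar>d t\<bar> \<and> \<bar>d t\<bar> \<le> M\<^sup>2"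
      and sub: "\<forall>a\<in>{1 / (2 * M\<^sup>2)<..<2 * M\<^sup>2}. \<forall>N>N\<^sub>1.
          measure lebesgue ({t. \<bar>\<bar>d t\<bar> - a\<bar> \<le> 1 / N powr (1 - \<eta>\<^sub>0)} \<inter> {p..q})
            \<le> C * (1 / N powr \<eta>\<^sub>1)"
    let ?E = "{t \<in> {p..q}. \<bar>d t - c\<bar> \<le> \<epsilon>}"
    show "measure lebesgue ?E \<le> \<tau>"
    proof (cases "\<bar>c\<bar> \<in> {1 / (2 * M\<^sup>2)<..<2 * M\<^sup>2}")
      case True
      let ?F = "{t. \<bar>\<bar>d t\<bar> - \<bar>c\<bar>\<bar> \<le> 1 / N powr (1 - \<eta>\<^sub>0)} \<inter> {p..q}"
      have cl: "closed {t. \<bar>d t - c\<bar> \<le> \<epsilon>}" "closed {t. \<bar>\<bar>d t\<bar> - \<bar>c\<bar>\<bar> \<le> 1 / N powr (1 - \<eta>\<^sub>0)}"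
        by (intro closed_Collect_le continuous_intros cont)+
      have "?E = {t. \<bar>d t - c\<bar> \<le> \<epsilon>} \<inter> {p..q}" by auto
      then have "?E \<in> lmeasurable"
        using closed_Int_compact[OF cl(1) compact_Icc[of p q]] lmeasurable_compact by simp
      moreover have "?F \<in> lmeasurable"
        by (rule lmeasurable_compact[OF closed_Int_compact[OF cl(2) compact_Icc[of p q]]])
      moreover have "?E \<subseteq> ?F" unfolding \<epsilon>_def by (auto simp: abs_if split: if_splits)
      ultimately have "measure lebesgue ?E \<le> measure lebesgue ?F"
        by (intro measure_mono_fmeasurable) auto
      also have "\<dots> \<le> C * (1 / N powr \<eta>\<^sub>1)" using sub True N by blast
      also have "\<dots> \<le> \<bar>C\<bar> * (1 / N powr \<eta>\<^sub>1)" by (intro mult_right_mono) auto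
      finally show ?thesis using CN by linarith
    next
      case False
      have "\<epsilon> < \<bar>d t - c\<bar>" for t
      proof -
        have "2 * m \<le> \<bar>\<bar>d t\<bar> - \<bar>c\<bar>\<bar>"
          using False d[of t] m M2 unfolding m(3,4) by auto
        then show ?thesis using m unfolding \<epsilon>_def by (auto simp: min_def)
      qed
      then have E: "?E = {}" by (auto simp: not_le)
      show ?thesis unfolding E using \<tau> by simp
    qed
  qed
qed

section \<open>Integrals of continuous functions against exponentials\<close>

lemma LBINT_eq_integral:
  fixes f :: "real \<Rightarrow> complex"
  assumes "continuous_on {p..q} f" "\<And>t. t \<notin> {p..q} \<Longrightarrow> f t = 0"
  shows "(LBINT t. f t) = integral {p..q} f"
proof -
  have "(LBINT t. f t) = (LBINT t:{p..q}. f t)"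
    unfolding set_lebesgue_integral_def
    by (rule Bochner_Integration.integral_cong) (use assms(2) in \<open>auto simp: indicator_def\<close>)
  then show ?thesis
    using set_borel_integral_eq_integral(2)[OF borel_integrable_atLeastAtMost'[OF assms(1)]] by simp
qed

lemma continuous_on_cis_linear [continuous_intros]:
  "continuous_on S f \<Longrightarrow> continuous_on S (\<lambda>x. cis (f x))" for f :: "'a::topological_space \<Rightarrow> real"
  unfolding cis_conv_exp by (intro continuous_intros)

text \<open>Translation by half a period flips the sign of the exponential, so the integral equals half
  of one with \<open>g t - g (t + s)\<close> in place of \<open>g t\<close>, which is small by uniform continuity.\<close>

lemma riemann_lebesgue:
  fixes g :: "real \<Rightarrow> complex"
  assumes cont: "continuous_on UNIV g" and zero: "\<And>t. t \<notin> {p..q} \<Longrightarrow> g t = 0" and e: "e > 0"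
  obtains R where "\<And>a. \<bar>a\<bar> > R \<Longrightarrow> cmod (LBINT t. g t * cis (- (2 * pi * a * t))) < e"
proof -
  define L where "L = \<bar>q - p\<bar> + 2"
  have L: "L > 0" unfolding L_def by simp
  have "uniformly_continuous_on {p-2..q+2} g"
    by (intro compact_uniformly_continuous continuous_on_subset[OF cont]) auto
  then obtain d where d: "d > 0"
    "\<And>x y. \<lbrakk>x \<in> {p-2..q+2}; y \<in> {p-2..q+2}; dist y x < d\<rbrakk> \<Longrightarrow> dist (g y) (g x) < e / L"
    using e L unfolding uniformly_continuous_on_def by (metis divide_pos_pos)
  show ?thesis
  proof
    fix a :: real assume a: "\<bar>a\<bar> > 1 / min 1 d"
    define s where "s = 1 / (2 * a)"
    have a0: "a \<noteq> 0" using a d(1) by auto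
    have "1 / \<bar>a\<bar> < r" if "r > 0" "\<bar>a\<bar> > 1 / r" for r
      using that a0 by (simp add: divide_less_eq mult.commute)
    from this[of "min 1 d"] have "1 / \<bar>a\<bar> < min 1 d" using a d(1) by linarith
    moreover have "\<bar>s\<bar> \<le> 1 / \<bar>a\<bar>" unfolding s_def using a0
      by (simp add: abs_divide abs_mult divide_simps)
    ultimately have s: "\<bar>s\<bar> < min 1 d" by linarith
    let ?F = "LBINT t. g t * cis (- (2 * pi * a * t))"
    let ?I = "{p-1..q+1}"
    have cg: "continuous_on S g" for S using cont continuous_on_subset by blast
    have cgs: "continuous_on S (\<lambda>t. g (t + s))" for S
      by (rule continuous_on_compose2[OF cont]) (auto intro: continuous_intros)
    have 1: "?F = integral ?I (\<lambda>t. g t * cis (- (2 * pi * a * t)))"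
      by (rule LBINT_eq_integral) (auto intro!: continuous_intros cg zero)
    have "cis (- (2 * pi * a * (s + t))) = - cis (- (2 * pi * a * t))" for t
    proof -
      have "- (2 * pi * a * (s + t)) = - (2 * pi * a * t) - pi"
        unfolding s_def using a0 by (simp add: field_simps)
      then show ?thesis by (simp add: cis_divide[symmetric])
    qed
    then have "?F = - (LBINT t. g (t + s) * cis (- (2 * pi * a * t)))"
      using lborel_integral_real_affine[of 1 "\<lambda>t. g t * cis (- (2 * pi * a * t))" s]
      by (simp add: add.commute)
    also have "(LBINT t. g (t + s) * cis (- (2 * pi * a * t)))
        = integral ?I (\<lambda>t. g (t + s) * cis (- (2 * pi * a * t)))"
      using s by (intro LBINT_eq_integral) (auto intro!: continuous_intros cgs zero)
    finally have 2: "?F = - integral ?I (\<lambda>t. g (t + s) * cis (- (2 * pi * a * t)))" .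
    have "2 * ?F = integral ?I (\<lambda>t. g t * cis (- (2 * pi * a * t)))
        - integral ?I (\<lambda>t. g (t + s) * cis (- (2 * pi * a * t)))"
      using 1 2 by simp
    also have "\<dots> = integral ?I (\<lambda>t. (g t - g (t + s)) * cis (- (2 * pi * a * t)))"
      unfolding left_diff_distrib
      by (rule integral_diff[symmetric])
        (auto intro!: integrable_continuous_real continuous_intros cg cgs)
    finally have dbl: "2 * ?F = integral ?I (\<lambda>t. (g t - g (t + s)) * cis (- (2 * pi * a * t)))" .
    have "2 * cmod ?F = cmod (2 * ?F)" by (simp only: norm_mult norm_numeral)
    also have "\<dots> = cmod (integral ?I (\<lambda>t. (g t - g (t + s)) * cis (- (2 * pi * a * t))))"
      by (simp only: dbl)
    also have "\<dots> \<le> e / L * L"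
    proof (cases "p - 1 \<le> q + 1")
      case True
      have "cmod (integral ?I (\<lambda>t. (g t - g (t + s)) * cis (- (2 * pi * a * t))))
          \<le> e / L * (q + 1 - (p - 1))"
      proof (rule integral_bound[OF True])
        show "continuous_on ?I (\<lambda>t. (g t - g (t + s)) * cis (- (2 * pi * a * t)))"
          by (intro continuous_intros cg cgs)
        fix t assume t: "t \<in> ?I"
        have "dist (g (t + s)) (g t) < e / L"
          using t s by (intro d(2)) (auto simp: dist_real_def)
        then show "cmod ((g t - g (t + s)) * cis (- (2 * pi * a * t))) \<le> e / L"
          by (simp add: norm_mult dist_norm norm_minus_commute)
      qed
      also have "\<dots> \<le> e / L * L"
        using e L unfolding L_def by (intro mult_left_mono) auto
      finally show ?thesis .
    qed (use e L in auto)
    also have "\<dots> = e" using L by simp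
    finally show "cmod ?F < e" using e by simp
  qed
qed

text \<open>Frequencies range over the whole line; decay at infinity supplies the missing compactness.\<close>

lemma attains_max_of_decaying:
  fixes F :: "real \<Rightarrow> real"
  assumes cont: "continuous_on UNIV F" and nonneg: "\<And>a. F a \<ge> 0"
    and decay: "\<And>e. e > 0 \<Longrightarrow> \<exists>R. \<forall>a. \<bar>a\<bar> > R \<longrightarrow> F a < e"
  shows "\<exists>a. \<forall>x. F x \<le> F a"
proof (cases "\<forall>x. F x = 0")
  case False
  then obtain c where c: "F c > 0" using nonneg by (metis less_eq_real_def)
  then obtain R where R: "\<And>a. \<bar>a\<bar> > R \<Longrightarrow> F a < F c" using decay by blast
  let ?S = "{- max R \<bar>c\<bar>..max R \<bar>c\<bar>}"
  have "c \<in> ?S" by auto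
  then obtain a where a: "a \<in> ?S" "\<And>x. x \<in> ?S \<Longrightarrow> F x \<le> F a"
    using continuous_attains_sup[of ?S F] continuous_on_subset[OF cont] by (metis compact_Icc empty_iff subset_UNIV)
  have "F x \<le> F a" for x
  proof (cases "x \<in> ?S")
    case False
    then have "\<bar>x\<bar> > R" by auto
    then show ?thesis using R[of x] a(2)[OF \<open>c \<in> ?S\<close>] by linarith
  qed (use a in auto)
  then show ?thesis by blast
qed auto

section \<open>Shape functions\<close>

lemma shape_continuous:
  assumes "\<sigma> \<in> shape_functions M"
  shows "continuous_on S \<sigma>"
proof -
  have "continuous_on UNIV \<sigma>"
  proof (rule uniform_limit_theorem)
    show "uniform_limit UNIV
       (\<lambda>m t. \<Sum>n\<in>{- int m..int m}. fourier_coeff \<sigma> n * cis (of_int n * t)) \<sigma> sequentially"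
      using assms unfolding shape_functions_def by blast
  qed (auto intro!: always_eventually continuous_intros)
  then show ?thesis using continuous_on_subset by blast
qed

text \<open>The greatest common divisor of the empty set is 0, not 1. This is what makes the largest
  coefficient \<open>s\<^sub>0\<close> positive.\<close>

lemma shape_nonzero_coeff:
  assumes "\<sigma> \<in> shape_functions M"
  shows "\<exists>n. fourier_coeff \<sigma> n \<noteq> 0"
proof (rule ccontr)
  assume "\<not> ?thesis"
  then have "{\<bar>n\<bar> |n. fourier_coeff \<sigma> n \<noteq> 0} = {}" by auto
  then show False using assms unfolding shape_functions_def by auto
qed

text \<open>A bound on the integral against each single harmonic passes to the shape function because
  the coefficients have total mass at most \<open>M\<close>; the partial sums of the Fourier series converge
  uniformly, which avoids exchanging an infinite sum with the integral. One distinguished harmonic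
  \<open>l\<close> may be split off. With \<open>l = 0\<close> nothing is split off, as the zeroth coefficient vanishes.\<close>

lemma shape_integral_bound:
  fixes \<sigma> A :: "real \<Rightarrow> complex" and \<theta> :: "real \<Rightarrow> real"
  assumes \<sigma>: "\<sigma> \<in> shape_functions M"
    and cont: "continuous_on {p..q} A" "continuous_on {p..q} \<theta>"
    and B: "\<And>n. \<lbrakk>n \<noteq> l; n \<noteq> 0\<rbrakk> \<Longrightarrow> cmod (integral {p..q} (\<lambda>t. A t * cis (of_int n * \<theta> t))) \<le> B"
      "B \<ge> 0"
  shows "cmod (integral {p..q} (\<lambda>t. A t * \<sigma> (\<theta> t))
    - fourier_coeff \<sigma> l * integral {p..q} (\<lambda>t. A t * cis (of_int l * \<theta> t))) \<le> M * B"
proof -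
  let ?c = "fourier_coeff \<sigma>"
  define I where "I = (\<lambda>n. integral {p..q} (\<lambda>t. A t * cis (of_int n * \<theta> t)))"
  have ul: "uniform_limit UNIV (\<lambda>m t. \<Sum>n\<in>{- int m..int m}. ?c n * cis (of_int n * t)) \<sigma> sequentially"
    and c0: "?c 0 = 0" and sm: "(\<lambda>n. cmod (?c n)) summable_on UNIV"
    and cM: "(\<Sum>\<^sub>\<infinity>n. cmod (?c n)) \<le> M"
    using \<sigma> unfolding shape_functions_def wiener_algebra_def by auto
  let ?P = "\<lambda>m t. A t * (\<Sum>n\<in>{- int m..int m}. ?c n * cis (of_int n * \<theta> t))"
  have c\<sigma>: "continuous_on {p..q} (\<lambda>t. \<sigma> (\<theta> t))"
    using continuous_on_compose2[OF shape_continuous[OF \<sigma>, of UNIV] cont(2)] by simp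
  have u: "uniform_limit {p..q} ?P (\<lambda>t. A t * \<sigma> (\<theta> t)) sequentially"
  proof (rule uniform_lim_mult)
    show "uniform_limit {p..q} (\<lambda>m t. \<Sum>n\<in>{- int m..int m}. ?c n * cis (of_int n * \<theta> t))
        (\<lambda>t. \<sigma> (\<theta> t)) sequentially"
      using uniform_limit_compose'[OF ul, of \<theta> "{p..q}"] by simp
  qed (auto intro!: uniform_limit_const compact_imp_bounded compact_continuous_image cont c\<sigma>)
  have "continuous_on {p..q} (?P m)" for m
    by (intro continuous_intros cont)
  then obtain II J where IJ: "\<And>m. (?P m has_integral II m) {p..q}"
      "((\<lambda>t. A t * \<sigma> (\<theta> t)) has_integral J) {p..q}" "II \<longlonglongrightarrow> J"
    using uniform_limit_integral[OF u _ sequentially_bot] by blast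
  have "II m = (\<Sum>n\<in>{- int m..int m}. ?c n * I n)" for m
  proof -
    have "((\<lambda>t. A t * cis (of_int n * \<theta> t)) has_integral I n) {p..q}" for n
      unfolding I_def
      by (intro integrable_integral integrable_continuous_real continuous_intros cont)
    then have "((\<lambda>t. \<Sum>n\<in>{- int m..int m}. ?c n * (A t * cis (of_int n * \<theta> t))) has_integral
        (\<Sum>n\<in>{- int m..int m}. ?c n * I n)) {p..q}"
      by (intro has_integral_sum has_integral_mult_right) simp_all
    moreover have "?P m = (\<lambda>t. \<Sum>n\<in>{- int m..int m}. ?c n * (A t * cis (of_int n * \<theta> t)))"
      by (simp add: sum_distrib_left mult_ac)
    ultimately show ?thesis using has_integral_unique[OF IJ(1)[of m]] by (simp only:)
  qed
  note II = this
  have le: "cmod (II m - ?c l * I l) \<le> M * B" if m: "m \<ge> nat \<bar>l\<bar>" for m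
  proof -
    let ?S = "{- int m..int m}"
    have "l \<in> ?S" using m by auto
    then have "II m - ?c l * I l = (\<Sum>n\<in>?S - {l}. ?c n * I n)"
      unfolding II by (simp add: sum_diff1)
    also have "cmod \<dots> \<le> (\<Sum>n\<in>?S - {l}. cmod (?c n) * B)"
    proof (rule sum_norm_le)
      fix n assume "n \<in> ?S - {l}"
      then show "cmod (?c n * I n) \<le> cmod (?c n) * B"
        using B(1)[of n] c0 unfolding I_def by (cases "n = 0") (auto simp: norm_mult intro: mult_left_mono)
    qed
    also have "\<dots> = (\<Sum>n\<in>?S - {l}. cmod (?c n)) * B" by (simp add: sum_distrib_right)
    also have "\<dots> \<le> M * B"
      using finite_sum_le_infsum[OF sm, of "?S - {l}"] cM B(2) by (intro mult_right_mono) auto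
    finally show ?thesis .
  qed
  have "(\<lambda>m. cmod (II m - ?c l * I l)) \<longlonglongrightarrow> cmod (J - ?c l * I l)"
    by (intro tendsto_intros IJ)
  then have "cmod (J - ?c l * I l) \<le> M * B"
    by (rule tendsto_upperbound) (use le in \<open>auto simp: eventually_sequentially\<close>)
  then show ?thesis using integral_unique[OF IJ(2)] unfolding I_def by simp
qed

section \<open>The windowed transform\<close>

lemma window_vanishes:
  assumes "window w" "\<bar>t\<bar> \<ge> 1"
  shows "w t = 0"
proof (rule ccontr)
  assume "w t \<noteq> 0"
  then have "t \<in> closure {t. w t \<noteq> 0}" using closure_subset[of "{t. w t \<noteq> 0}"] by auto
  moreover have "closure {t. w t \<noteq> 0} \<subseteq> {-1<..<1}" using assms(1) unfolding window_def by blast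
  ultimately have "t \<in> {-1<..<1}" by (rule rev_subsetD)
  then show False using assms(2) by (simp add: abs_if split: if_splits)
qed

lemma window_bounds:
  assumes "window w"
  obtains W\<^sub>0 W\<^sub>1 where "W\<^sub>0 \<ge> 0" "W\<^sub>1 \<ge> 0"
    "\<And>t. \<bar>t\<bar> \<le> 1 \<Longrightarrow> \<bar>w t\<bar> \<le> W\<^sub>0" "\<And>t. \<bar>t\<bar> \<le> 1 \<Longrightarrow> \<bar>deriv w t\<bar> \<le> W\<^sub>1"
proof -
  have bd: "\<exists>B\<ge>0. \<forall>t. \<bar>t\<bar> \<le> 1 \<longrightarrow> \<bar>f t\<bar> \<le> B" if "smooth f" for f
  proof -
    have "bounded (f ` {-1..1})"
      by (intro compact_imp_bounded compact_continuous_image smooth_continuous that compact_Icc)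
    then obtain B where B: "B > 0" "\<And>x. x \<in> f ` {-1..1} \<Longrightarrow> norm x \<le> B"
      unfolding bounded_pos by blast
    have "\<bar>f t\<bar> \<le> B" if "\<bar>t\<bar> \<le> 1" for t
      using B(2)[OF imageI[of t "{-1..1}" f]] that by (simp add: abs_le_iff)
    then show ?thesis using B(1) by (intro exI[of _ B]) auto
  qed
  have sm: "smooth w" using assms unfolding window_def by blast
  show ?thesis
    using that bd[OF sm] bd[OF smooth_deriv[OF sm]] by blast
qed

lemma continuous_on_scaled_window [continuous_intros]:
  assumes "window w"
  shows "continuous_on S (\<lambda>t. w ((t - b) / T))"
proof -
  have "continuous_on UNIV w" using assms unfolding window_def by (simp add: smooth_continuous)
  then show ?thesis
    by (rule continuous_on_compose2) (auto simp: divide_inverse intro!: continuous_intros)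
qed

lemma scaled_window_vanishes:
  assumes "window w" "T > 0" "t \<notin> {b - T..b + T}"
  shows "w ((t - b) / T) = 0"
  using assms by (intro window_vanishes[OF assms(1)]) (auto simp: abs_divide pos_le_divide_eq)

lemma stft_eq_integral:
  assumes "window w" "T > 0" "continuous_on UNIV g"
  shows "stft w T g a b
    = integral {b - T..b + T} (\<lambda>t. g t * of_real (w ((t - b) / T)) * cis (- (2 * pi * a * t)))"
  unfolding stft_def
proof (rule LBINT_eq_integral)
  show "continuous_on {b - T..b + T}
      (\<lambda>t. g t * of_real (w ((t - b) / T)) * cis (- (2 * pi * a * t)))"
    using continuous_on_subset[OF assms(3)] by (intro continuous_intros assms(1)) auto
qed (simp add: scaled_window_vanishes[OF assms(1,2)])

lemma stft_attains_max:
  assumes w: "window w" and T: "T > 0" and g: "continuous_on UNIV g"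
  shows "\<exists>a. \<forall>x. cmod (stft w T g x b) \<le> cmod (stft w T g a b)"
proof (rule attains_max_of_decaying)
  let ?g = "\<lambda>t. g t * of_real (w ((t - b) / T))"
  have cg: "continuous_on S g" for S using g continuous_on_subset by blast
  have "continuous_on UNIV (\<lambda>a. integral (cbox (b - T) (b + T)) (\<lambda>t. ?g t * cis (- (2 * pi * a * t))))"
  proof (rule integral_continuous_on_param)
    have "continuous_on UNIV ?g"
      by (intro continuous_intros cg w)
    then have c: "continuous_on (UNIV \<times> cbox (b - T) (b + T)) (\<lambda>x :: real \<times> real. ?g (snd x))"
      by (rule continuous_on_compose2) (auto intro: continuous_intros)
    show "continuous_on (UNIV \<times> cbox (b - T) (b + T))
        (\<lambda>(a, t). ?g t * cis (- (2 * pi * a * t)))"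
      unfolding case_prod_unfold by (intro continuous_on_mult[OF c] continuous_intros)
  qed
  then show "continuous_on UNIV (\<lambda>a. cmod (stft w T g a b))"
    unfolding stft_eq_integral[OF w T g] by (intro continuous_intros) simp
  fix e :: real assume e: "e > 0"
  show "\<exists>R. \<forall>a. \<bar>a\<bar> > R \<longrightarrow> cmod (stft w T g a b) < e"
  proof (rule riemann_lebesgue[of ?g "b - T" "b + T" e])
    show "continuous_on UNIV ?g" by (intro continuous_intros cg w)
    fix R assume "\<And>a. \<bar>a\<bar> > R \<Longrightarrow> cmod (LBINT t. ?g t * cis (- (2 * pi * a * t))) < e"
    then show ?thesis unfolding stft_def by blast
  qed (simp_all add: e scaled_window_vanishes[OF w T])
qed simp

text \<open>The substitution \<open>t = b + T x\<close>: the window scaled by \<open>T\<close> has its spectrum concentrated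
  by the same factor, and the position \<open>b\<close> only produces a unimodular factor.\<close>

lemma windowed_exponential_integral:
  assumes w: "window w" and T: "T > 0"
  shows "cmod (integral {b - T..b + T} (\<lambda>t. of_real (w ((t - b) / T)) * cis (2 * pi * (\<nu> - a) * t)))
    = T * cmod (fourier_transform w (T * (a - \<nu>)))"
proof -
  let ?F = "\<lambda>t. of_real (w ((t - b) / T)) * cis (2 * pi * (\<nu> - a) * t)"
  have "integral {b - T..b + T} ?F = (LBINT t. ?F t)"
    by (rule LBINT_eq_integral[symmetric])
      (auto intro!: continuous_intros w simp: scaled_window_vanishes[OF w T])
  also have "\<dots> = T *\<^sub>R (LBINT x. ?F (b + T * x))"
    using lborel_integral_real_affine[of T ?F b] T by simp
  also have "(\<lambda>x. ?F (b + T * x)) = (\<lambda>x. cis (2 * pi * (\<nu> - a) * b) *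
      (of_real (w x) * cis (- (2 * pi * (T * (a - \<nu>)) * x))))"
  proof
    fix x
    have "cis (2 * pi * (\<nu> - a) * (b + T * x))
        = cis (2 * pi * (\<nu> - a) * b) * cis (- (2 * pi * (T * (a - \<nu>)) * x))"
      unfolding cis_mult by (rule arg_cong[of _ _ cis]) (simp add: algebra_simps)
    then show "?F (b + T * x) = cis (2 * pi * (\<nu> - a) * b) *
      (of_real (w x) * cis (- (2 * pi * (T * (a - \<nu>)) * x)))"
      using T by simp
  qed
  finally show ?thesis
    unfolding fourier_transform_def using T by (simp add: norm_mult)
qed

section \<open>Interaction of different components\<close>

text \<open>The bound \<open>\<kappa>\<close> is split into three equal parts: \<open>\<epsilon>\<close> makes the measure of the nearly
  stationary set contribute one third, \<open>\<rho>\<close> makes the tail \<open>\<rho>\<^sup>2 / \<epsilon>\<^sup>2\<close> contribute another, and only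
  then \<open>N\<^sub>0\<close> makes the integration by parts contribute the last. None of these choices sees the
  phases, the amplitudes or the frequency \<open>a\<close>.\<close>

lemma cross_integral_uniformly_small:
  fixes M T b \<eta>\<^sub>0 \<eta>\<^sub>1 N\<^sub>1 C \<kappa> :: real
  assumes w: "window w" and M: "M \<ge> 1" and T: "T > 0" and \<eta>\<^sub>1: "\<eta>\<^sub>1 > 0" and \<kappa>: "\<kappa> > 0"
  obtains N\<^sub>0 where "N\<^sub>0 > 0"
    "\<And>\<alpha>\<^sub>1 \<alpha>\<^sub>2 \<phi>\<^sub>1 \<phi>\<^sub>2 \<Lambda> a. \<lbrakk>tame M \<alpha>\<^sub>1; tame M \<alpha>\<^sub>2; smooth \<phi>\<^sub>1; tame M (deriv \<phi>\<^sub>1); smooth \<phi>\<^sub>2; tame M (deriv \<phi>\<^sub>2);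
        \<forall>a\<in>{1 / (2 * M\<^sup>2)<..<2 * M\<^sup>2}. \<forall>N>N\<^sub>1.
          measure lebesgue ({t. \<bar>\<bar>deriv (\<phi>\<^sub>1 \<circ> inv \<phi>\<^sub>2) t\<bar> - a\<bar> \<le> 1 / N powr (1 - \<eta>\<^sub>0)} \<inter> {b - T..b + T})
            \<le> C * (1 / N powr \<eta>\<^sub>1);
        \<bar>\<Lambda>\<bar> > N\<^sub>0\<rbrakk>
      \<Longrightarrow> cmod (integral {b - T..b + T} (\<lambda>t. of_real (\<alpha>\<^sub>1 (inv \<phi>\<^sub>2 t) / \<alpha>\<^sub>2 (inv \<phi>\<^sub>2 t) * w ((t - b) / T))
            * cis (2 * pi * (\<Lambda> * \<phi>\<^sub>1 (inv \<phi>\<^sub>2 t) - a * t)))) \<le> \<kappa>"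
proof -
  have M0: "M > 0" using M by simp
  obtain W\<^sub>0 W\<^sub>1 where W: "W\<^sub>0 \<ge> 0" "W\<^sub>1 \<ge> 0"
    "\<And>t. \<bar>t\<bar> \<le> 1 \<Longrightarrow> \<bar>w t\<bar> \<le> W\<^sub>0" "\<And>t. \<bar>t\<bar> \<le> 1 \<Longrightarrow> \<bar>deriv w t\<bar> \<le> W\<^sub>1"
    using window_bounds[OF w] by blast
  have sw: "smooth w" using w unfolding window_def by blast
  \<comment> \<open>Bounds for the warped amplitude (positive, to be divided by), its derivative, and the second derivative of the transition map.\<close>
  define A\<^sub>0 where "A\<^sub>0 = M\<^sup>2 * W\<^sub>0 + 1"
  define A\<^sub>1 where "A\<^sub>1 = 2 * M ^ 5 * W\<^sub>0 + M\<^sup>2 * (W\<^sub>1 / T)"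
  define D where "D = 2 * M ^ 5"
  have A: "A\<^sub>0 > 0" "A\<^sub>1 \<ge> 0" "D > 0"
    unfolding A\<^sub>0_def A\<^sub>1_def D_def using W T M0 by (auto intro!: add_nonneg_pos)
  define \<tau> where "\<tau> = \<kappa> / (3 * A\<^sub>0)"
  have \<tau>: "\<tau> > 0" unfolding \<tau>_def using \<kappa> A by simp
  obtain \<epsilon> where \<epsilon>: "\<epsilon> > 0"
    and small: "\<And>(d :: real \<Rightarrow> real) c. \<lbrakk>continuous_on UNIV d; \<And>t. 1 / M\<^sup>2 \<le> \<bar>d t\<bar> \<and> \<bar>d t\<bar> \<le> M\<^sup>2;
        \<forall>a\<in>{1 / (2 * M\<^sup>2)<..<2 * M\<^sup>2}. \<forall>N>N\<^sub>1.
          measure lebesgue ({t. \<bar>\<bar>d t\<bar> - a\<bar> \<le> 1 / N powr (1 - \<eta>\<^sub>0)} \<inter> {b - T..b + T})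
            \<le> C * (1 / N powr \<eta>\<^sub>1)\<rbrakk>
      \<Longrightarrow> measure lebesgue {t \<in> {b - T..b + T}. \<bar>d t - c\<bar> \<le> \<epsilon>} \<le> \<tau>"
    using sublevel_sets_uniformly_small[OF M \<eta>\<^sub>1 \<tau>] by blast
  define \<rho> where "\<rho> = \<epsilon> * sqrt (\<kappa> / (6 * T * A\<^sub>0))"
  have \<rho>: "\<rho> > 0" unfolding \<rho>_def using \<epsilon> \<kappa> T A by simp
  have "\<rho>\<^sup>2 = \<epsilon>\<^sup>2 * (\<kappa> / (6 * T * A\<^sub>0))"
    unfolding \<rho>_def power_mult_distrib using \<kappa> T A by (subst real_sqrt_pow2) auto
  then have \<rho>\<epsilon>: "\<rho>\<^sup>2 / \<epsilon>\<^sup>2 = \<kappa> / (6 * T * A\<^sub>0)" using \<epsilon> by simp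
  define Q where "Q = 2 * T * (A\<^sub>1 / (2 * \<rho>) + A\<^sub>0 * D / \<rho>\<^sup>2)"
  have Q: "Q \<ge> 0" unfolding Q_def using A T \<rho> by simp
  show ?thesis
  proof
    show "3 * Q / \<kappa> + 1 > 0" using Q \<kappa> by (simp add: add_nonneg_pos)
    fix \<alpha>\<^sub>1 \<alpha>\<^sub>2 \<phi>\<^sub>1 \<phi>\<^sub>2 :: "real \<Rightarrow> real" and \<Lambda> a :: real
    assume \<alpha>: "tame M \<alpha>\<^sub>1" "tame M \<alpha>\<^sub>2"
      and \<phi>\<^sub>1: "smooth \<phi>\<^sub>1" "tame M (deriv \<phi>\<^sub>1)" and \<phi>\<^sub>2: "smooth \<phi>\<^sub>2" "tame M (deriv \<phi>\<^sub>2)"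
      and sub: "\<forall>a\<in>{1 / (2 * M\<^sup>2)<..<2 * M\<^sup>2}. \<forall>N>N\<^sub>1.
          measure lebesgue ({t. \<bar>\<bar>deriv (\<phi>\<^sub>1 \<circ> inv \<phi>\<^sub>2) t\<bar> - a\<bar> \<le> 1 / N powr (1 - \<eta>\<^sub>0)} \<inter> {b - T..b + T})
            \<le> C * (1 / N powr \<eta>\<^sub>1)"
      and \<Lambda>: "\<bar>\<Lambda>\<bar> > 3 * Q / \<kappa> + 1"
    let ?X = "inv \<phi>\<^sub>2"
    let ?I = "{b - T..b + T}"
    have \<Lambda>1: "\<bar>\<Lambda>\<bar> > 1" "\<bar>\<Lambda>\<bar> > 3 * Q / \<kappa>"
      using \<Lambda> Q \<kappa> divide_nonneg_pos[of "3 * Q" \<kappa>] by linarith+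
    define \<psi> where "\<psi> = (\<lambda>t. \<phi>\<^sub>1 (?X t))"
    define d where "d = (\<lambda>t. deriv \<phi>\<^sub>1 (?X t) / deriv \<phi>\<^sub>2 (?X t))"
    have d\<psi>: "(\<psi> has_real_derivative d t) (at t)" for t
      using transition_has_deriv[OF \<phi>\<^sub>2 \<phi>\<^sub>1(1) M0, of t] unfolding \<psi>_def d_def comp_def .
    have dd: "deriv (\<phi>\<^sub>1 \<circ> ?X) = d"
      using transition_has_deriv[OF \<phi>\<^sub>2 \<phi>\<^sub>1(1) M0] DERIV_imp_deriv unfolding d_def by blast
    obtain d' where d': "continuous_on UNIV d'" "\<And>t. (d has_real_derivative d' t) (at t)"
        "\<And>t. \<bar>d' t\<bar> \<le> D"
      using tame_quotient_along_inverse[OF \<phi>\<^sub>1(2) \<phi>\<^sub>2(2) \<phi>\<^sub>2 M0] unfolding d_def D_def by blast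
    obtain Q' where Q': "continuous_on UNIV Q'"
        "\<And>t. ((\<lambda>t. \<alpha>\<^sub>1 (?X t) / \<alpha>\<^sub>2 (?X t)) has_real_derivative Q' t) (at t)" "\<And>t. \<bar>Q' t\<bar> \<le> 2 * M ^ 5"
      using tame_quotient_along_inverse[OF \<alpha> \<phi>\<^sub>2 M0] by blast
    define w' where "w' = (\<lambda>t. deriv w ((t - b) / T) / T)"
    have dw: "((\<lambda>t. w ((t - b) / T)) has_real_derivative w' t) (at t)" for t
    proof -
      have "((\<lambda>t. (t - b) / T) has_real_derivative 1 / T) (at t)"
        using T by (auto intro!: derivative_eq_intros)
      from DERIV_chain2[OF smooth_has_deriv[OF sw] this] show ?thesis
        unfolding w'_def by simp
    qed
    have cd: "continuous_on S d" for S
      by (meson DERIV_isCont continuous_at_imp_continuous_on d'(2))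
    have cw': "continuous_on UNIV w'"
      unfolding w'_def using T
      by (intro continuous_on_divide continuous_on_compose2[OF smooth_continuous[OF smooth_deriv[OF sw], of UNIV]])
        (auto intro!: continuous_intros)
    define Amp where "Amp = (\<lambda>t. \<alpha>\<^sub>1 (?X t) / \<alpha>\<^sub>2 (?X t) * w ((t - b) / T))"
    define Amp' where "Amp' = (\<lambda>t. Q' t * w ((t - b) / T) + w' t * (\<alpha>\<^sub>1 (?X t) / \<alpha>\<^sub>2 (?X t)))"
    have cq: "continuous_on UNIV (\<lambda>t. \<alpha>\<^sub>1 (?X t) / \<alpha>\<^sub>2 (?X t))"
      by (rule continuous_at_imp_continuous_on) (use DERIV_isCont[OF Q'(2)] in blast)
    \<comment> \<open>The factor \<open>\<Lambda>\<close> is taken out of the phase, so that \<open>a\<close> enters only through the level \<open>c\<close>.\<close>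
    define c where "c = a / \<Lambda>"
    have "cmod (integral ?I (\<lambda>t. of_real (Amp t) * cis (2 * pi * \<Lambda> * (\<psi> t - c * t))))
      \<le> A\<^sub>0 * integral ?I (\<lambda>t. \<rho>\<^sup>2 / ((d t - c)\<^sup>2 + \<rho>\<^sup>2))
        + (b + T - (b - T)) * (A\<^sub>1 / (2 * \<rho>) + A\<^sub>0 * D / \<rho>\<^sup>2) / \<bar>2 * pi * \<Lambda>\<bar>"
    proof (rule oscillatory_integral_bound[where A' = Amp' and u' = d'])
      show "Amp (b - T) = 0" "Amp (b + T) = 0"
        unfolding Amp_def using T by (simp_all add: window_vanishes[OF w])
      show "(Amp has_real_derivative Amp' t) (at t)" for t
        unfolding Amp_def Amp'_def by (rule DERIV_mult[OF Q'(2) dw])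
      show "((\<lambda>t. \<psi> t - c * t) has_real_derivative d t - c) (at t)" for t
        by (rule derivative_eq_intros d\<psi> refl)+ simp
      show "((\<lambda>t. d t - c) has_real_derivative d' t) (at t)" for t
        by (rule derivative_eq_intros d' refl)+ simp
      show "continuous_on UNIV Amp'"
        unfolding Amp'_def by (intro continuous_on_add continuous_on_mult Q' cw' cq
            continuous_on_scaled_window[OF w])
      fix t assume "t \<in> ?I"
      then have t1: "\<bar>(t - b) / T\<bar> \<le> 1" using T by (auto simp: abs_divide abs_le_iff)
      have qb: "\<bar>\<alpha>\<^sub>1 (?X t) / \<alpha>\<^sub>2 (?X t)\<bar> \<le> M\<^sup>2" by (rule tame_quotient_bounds[OF \<alpha> M0])
      have "\<bar>Amp t\<bar> \<le> M\<^sup>2 * W\<^sub>0"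
        unfolding Amp_def abs_mult using qb W(3)[OF t1] by (intro mult_mono) auto
      then show "\<bar>Amp t\<bar> \<le> A\<^sub>0" unfolding A\<^sub>0_def by simp
      have "\<bar>w' t\<bar> \<le> W\<^sub>1 / T"
        unfolding w'_def abs_divide using W(4)[OF t1] T by (simp add: divide_right_mono)
      then have "\<bar>Q' t\<bar> * \<bar>w ((t - b) / T)\<bar> + \<bar>w' t\<bar> * \<bar>\<alpha>\<^sub>1 (?X t) / \<alpha>\<^sub>2 (?X t)\<bar>
          \<le> 2 * M ^ 5 * W\<^sub>0 + W\<^sub>1 / T * M\<^sup>2"
        using qb W(3)[OF t1] Q'(3)[of t] W T M0 by (intro add_mono mult_mono) auto
      moreover have "\<bar>Amp' t\<bar> \<le> \<bar>Q' t\<bar> * \<bar>w ((t - b) / T)\<bar> + \<bar>w' t\<bar> * \<bar>\<alpha>\<^sub>1 (?X t) / \<alpha>\<^sub>2 (?X t)\<bar>"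
        unfolding Amp'_def by (metis abs_mult abs_triangle_ineq)
      ultimately show "\<bar>Amp' t\<bar> \<le> A\<^sub>1" unfolding A\<^sub>1_def by (simp add: mult.commute)
    qed (use T d' \<rho> \<Lambda>1 in auto)
    also have "\<dots> \<le> A\<^sub>0 * (\<tau> + 2 * T * (\<rho>\<^sup>2 / \<epsilon>\<^sup>2)) + \<kappa> / 3"
    proof (intro add_mono mult_left_mono)
      have I_len: "b + T - (b - T) = 2 * T" by simp
      have "measure lebesgue {t \<in> ?I. \<bar>d t - c\<bar> \<le> \<epsilon>} \<le> \<tau>"
      proof (rule small[OF cd])
        show "1 / M\<^sup>2 \<le> \<bar>d t\<bar> \<and> \<bar>d t\<bar> \<le> M\<^sup>2" for t
          unfolding d_def using tame_quotient_bounds[OF \<phi>\<^sub>1(2) \<phi>\<^sub>2(2) M0] by blast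
      qed (use sub in \<open>simp only: dd\<close>)
      then have "measure lebesgue {t \<in> ?I. \<bar>d t - c\<bar> \<le> \<epsilon>} + (b + T - (b - T)) * (\<rho>\<^sup>2 / \<epsilon>\<^sup>2)
          \<le> \<tau> + 2 * T * (\<rho>\<^sup>2 / \<epsilon>\<^sup>2)"
        unfolding I_len by (rule add_right_mono)
      moreover have "integral ?I (\<lambda>t. \<rho>\<^sup>2 / ((d t - c)\<^sup>2 + \<rho>\<^sup>2))
          \<le> measure lebesgue {t \<in> ?I. \<bar>d t - c\<bar> \<le> \<epsilon>} + (b + T - (b - T)) * (\<rho>\<^sup>2 / \<epsilon>\<^sup>2)"
        using T by (intro integral_near_zero_set_bound \<rho> \<epsilon> continuous_intros cd) auto
      ultimately show "integral ?I (\<lambda>t. \<rho>\<^sup>2 / ((d t - c)\<^sup>2 + \<rho>\<^sup>2)) \<le> \<tau> + 2 * T * (\<rho>\<^sup>2 / \<epsilon>\<^sup>2)"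
        by (rule order.trans[rotated])
      have "(b + T - (b - T)) * (A\<^sub>1 / (2 * \<rho>) + A\<^sub>0 * D / \<rho>\<^sup>2) / \<bar>2 * pi * \<Lambda>\<bar> = Q / (2 * pi * \<bar>\<Lambda>\<bar>)"
        unfolding Q_def by (simp add: abs_mult)
      also have "\<dots> \<le> Q / \<bar>\<Lambda>\<bar>"
      proof (rule divide_left_mono)
        have "1 * \<bar>\<Lambda>\<bar> \<le> 2 * pi * \<bar>\<Lambda>\<bar>" using pi_ge_two by (intro mult_right_mono) auto
        then show "\<bar>\<Lambda>\<bar> \<le> 2 * pi * \<bar>\<Lambda>\<bar>" by simp
      qed (use Q \<Lambda>1 in auto)
      also have "\<dots> \<le> \<kappa> / 3"
        using \<Lambda>1 \<kappa> by (simp add: field_simps)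
      finally show "(b + T - (b - T)) * (A\<^sub>1 / (2 * \<rho>) + A\<^sub>0 * D / \<rho>\<^sup>2) / \<bar>2 * pi * \<Lambda>\<bar> \<le> \<kappa> / 3" .
    qed (use A in auto)
    also have "\<dots> = \<kappa>"
      unfolding \<rho>\<epsilon> \<tau>_def using A T by (simp add: field_simps)
    finally have "cmod (integral ?I (\<lambda>t. of_real (Amp t) * cis (2 * pi * \<Lambda> * (\<psi> t - c * t)))) \<le> \<kappa>" .
    moreover have "2 * pi * \<Lambda> * (\<psi> t - c * t) = 2 * pi * (\<Lambda> * \<phi>\<^sub>1 (?X t) - a * t)" for t
      unfolding \<psi>_def c_def using \<Lambda>1 by (auto simp: field_simps)
    ultimately show "cmod (integral ?I (\<lambda>t. of_real (\<alpha>\<^sub>1 (?X t) / \<alpha>\<^sub>2 (?X t) * w ((t - b) / T))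
            * cis (2 * pi * (\<Lambda> * \<phi>\<^sub>1 (?X t) - a * t)))) \<le> \<kappa>"
      unfolding Amp_def by (simp only:)
  qed
qed

section \<open>The dominant harmonic\<close>

text \<open>The inequality \<open>M \<ge> 1\<close> follows from \<open>1 / M \<le> \<alpha> \<le> M\<close>.\<close>

lemma gimt_regular:
  assumes "is_gimt M N \<alpha> \<sigma> \<phi> g" "M > 0"
  shows "tame M \<alpha>" "smooth \<phi>" "tame M (deriv \<phi>)" "\<sigma> \<in> shape_functions M" "M \<ge> 1"
    "\<And>t. g t = of_real (\<alpha> t) * \<sigma> (2 * pi * N * \<phi> t)"
proof -
  have \<alpha>: "1 / M \<le> \<alpha> t" "\<alpha> t \<le> M" for t using assms(1) unfolding is_gimt_def by blast+
  have "1 / M > 0" using assms(2) by simp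
  then have "\<alpha> t > 0" for t using \<alpha>(1)[of t] by linarith
  then show "tame M \<alpha>" using assms(1) unfolding is_gimt_def tame_def by (simp add: less_imp_le)
  have "1 / M \<le> M" using \<alpha>(1)[of 0] \<alpha>(2)[of 0] by linarith
  then have "1\<^sup>2 \<le> M\<^sup>2" using assms(2) by (simp add: field_simps power2_eq_square)
  then show "M \<ge> 1" using assms(2) by (intro power2_le_imp_le[of 1 M]) auto
qed (use assms(1) smooth_deriv in \<open>auto simp: is_gimt_def tame_def\<close>)

lemma warped_continuous:
  assumes M: "M > 0" and f: "\<forall>t. f t = (\<Sum>k=1..K. g k t)"
    and gimt: "\<forall>k\<in>{1..K}. is_gimt M (NN k) (\<alpha> k) (s k) (\<phi> k) (g k)" and k: "k \<in> {1..K}"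
  shows "continuous_on UNIV (warped f (\<alpha> k) (\<phi> k))"
proof -
  note reg = gimt_regular[OF gimt[rule_format] M]
  have cX: "continuous_on UNIV (inv (\<phi> k))"
    using DERIV_isCont[OF inv_phase_has_deriv[OF reg(2,3)[OF k] M]]
    by (intro continuous_at_imp_continuous_on) blast
  have c\<alpha>: "continuous_on UNIV (\<alpha> j)" if "j \<in> {1..K}" for j
    using reg(1)[OF that] unfolding tame_def by (simp add: smooth_continuous)
  have "continuous_on UNIV (\<lambda>t. s j (2 * pi * NN j * \<phi> j t))" if "j \<in> {1..K}" for j
    by (rule continuous_on_compose2[OF shape_continuous[OF reg(4)[OF that], of UNIV]])
      (auto intro!: continuous_on_mult_left smooth_continuous[OF reg(2)[OF that]])
  then have "continuous_on UNIV (g j)" if "j \<in> {1..K}" for j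
    unfolding reg(6)[OF that] using that by (intro continuous_intros c\<alpha>)
  then have cf: "continuous_on UNIV f"
    unfolding f[rule_format] by (intro continuous_on_sum)
  show ?thesis
    unfolding warped_def using tame_nonzero[OF reg(1)[OF k] M]
    by (intro continuous_on_divide continuous_on_of_real
        continuous_on_compose2[OF cf cX] continuous_on_compose2[OF c\<alpha>[OF k] cX]) auto
qed

text \<open>Whatever the frequency \<open>a\<close>, the transform is that of the nearest harmonic alone, up to an
  error that vanishes as \<open>N\<close> grows. Half of the error budget goes to the other components, and
  half to the remaining harmonics of the same component, which are at distance at least
  \<open>N\<^sub>k / 2\<close> from \<open>a\<close> and so are damped by the decay of the window spectrum.\<close>

lemma stft_near_single_harmonic:
  fixes w :: "real \<Rightarrow> real" and M T b e B :: real and \<eta>\<^sub>0 \<eta>\<^sub>1 N\<^sub>1 C :: "real \<Rightarrow> real" and K :: nat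
  assumes w: "window w" and M: "M \<ge> 1" and T: "T > 0" and \<eta>\<^sub>1: "\<eta>\<^sub>1 T > 0" and e: "e > 0"
    and B: "\<And>\<xi>. \<bar>\<xi>\<bar> * cmod (fourier_transform w \<xi>) \<le> B"
  obtains N\<^sub>0 where "N\<^sub>0 > 0"
    "\<And>N (f :: real \<Rightarrow> complex) g \<alpha> s \<phi> NN k l a.
      \<lbrakk>N > N\<^sub>0; \<forall>t. f t = (\<Sum>k=1..K. g k t);
       \<forall>k\<in>{1..K}. is_gimt M (NN k) (\<alpha> k) (s k) (\<phi> k) (g k) \<and> N \<le> NN k;
       well_different \<eta>\<^sub>0 \<eta>\<^sub>1 N\<^sub>1 C M K \<phi> b; k \<in> {1..K}; \<bar>a - of_int l * NN k\<bar> \<le> NN k / 2\<rbrakk>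
      \<Longrightarrow> \<bar>cmod (stft w T (warped f (\<alpha> k) (\<phi> k)) a b)
          - cmod (fourier_coeff (s k) l) * (T * cmod (fourier_transform w (T * (a - of_int l * NN k))))\<bar> \<le> e"
proof -
  have M0: "M > 0" using M by simp
  have B0: "B \<ge> 0" using B[of 0] by simp
  define \<kappa> where "\<kappa> = e / (2 * (real K + 1)) / M"
  have \<kappa>: "\<kappa> > 0" unfolding \<kappa>_def using e M0 by (simp add: add_nonneg_pos)
  have M\<kappa>: "M * \<kappa> = e / (2 * (real K + 1))" unfolding \<kappa>_def using M0 by simp
  have "real K * (M * \<kappa>) \<le> (real K + 1) * (M * \<kappa>)"
    using \<kappa> M0 by (intro mult_right_mono) auto
  also have "\<dots> = e / 2"
    unfolding M\<kappa> by (simp add: divide_simps add_nonneg_eq_0_iff)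
  finally have \<kappa>e: "real K * (M * \<kappa>) \<le> e / 2" .
  obtain Nc where Nc: "Nc > 0"
    and cross: "\<And>\<alpha>\<^sub>1 \<alpha>\<^sub>2 \<phi>\<^sub>1 \<phi>\<^sub>2 \<Lambda> a. \<lbrakk>tame M \<alpha>\<^sub>1; tame M \<alpha>\<^sub>2; smooth \<phi>\<^sub>1; tame M (deriv \<phi>\<^sub>1);
        smooth \<phi>\<^sub>2; tame M (deriv \<phi>\<^sub>2);
        \<forall>a\<in>{1 / (2 * M\<^sup>2)<..<2 * M\<^sup>2}. \<forall>N>N\<^sub>1 T.
          measure lebesgue ({t. \<bar>\<bar>deriv (\<phi>\<^sub>1 \<circ> inv \<phi>\<^sub>2) t\<bar> - a\<bar> \<le> 1 / N powr (1 - \<eta>\<^sub>0 T)} \<inter> {b - T..b + T})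
            \<le> C T * (1 / N powr \<eta>\<^sub>1 T);
        \<bar>\<Lambda>\<bar> > Nc\<rbrakk>
      \<Longrightarrow> cmod (integral {b - T..b + T} (\<lambda>t. of_real (\<alpha>\<^sub>1 (inv \<phi>\<^sub>2 t) / \<alpha>\<^sub>2 (inv \<phi>\<^sub>2 t) * w ((t - b) / T))
            * cis (2 * pi * (\<Lambda> * \<phi>\<^sub>1 (inv \<phi>\<^sub>2 t) - a * t)))) \<le> \<kappa>"
    using cross_integral_uniformly_small[OF w M T \<eta>\<^sub>1 \<kappa>] by blast
  show ?thesis
  proof
    show "Nc + 4 * M * B / e > 0" using Nc M0 B0 e by (simp add: add_pos_nonneg)
    fix N and f :: "real \<Rightarrow> complex" and g \<alpha> s \<phi> NN k l a
    assume N: "N > Nc + 4 * M * B / e" and f: "\<forall>t. f t = (\<Sum>k=1..K. g k t)"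
      and gimt: "\<forall>k\<in>{1..K}. is_gimt M (NN k) (\<alpha> k) (s k) (\<phi> k) (g k) \<and> N \<le> NN k"
      and wd: "well_different \<eta>\<^sub>0 \<eta>\<^sub>1 N\<^sub>1 C M K \<phi> b" and k: "k \<in> {1..K}"
      and a: "\<bar>a - of_int l * NN k\<bar> \<le> NN k / 2"
    have "4 * M * B / e \<ge> 0" using M0 B0 e by simp
    then have NNc: "N > Nc" "N > 4 * M * B / e" "N > 0" using N Nc by linarith+
    have reg: "tame M (\<alpha> j)" "smooth (\<phi> j)" "tame M (deriv (\<phi> j))" "s j \<in> shape_functions M"
        "\<And>t. g j t = of_real (\<alpha> j t) * s j (2 * pi * NN j * \<phi> j t)" "N \<le> NN j" "NN j > 0"
      if "j \<in> {1..K}" for j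
    proof -
      have G: "is_gimt M (NN j) (\<alpha> j) (s j) (\<phi> j) (g j)" "N \<le> NN j" using gimt that by blast+
      show "tame M (\<alpha> j)" "smooth (\<phi> j)" "tame M (deriv (\<phi> j))" "s j \<in> shape_functions M"
        "\<And>t. g j t = of_real (\<alpha> j t) * s j (2 * pi * NN j * \<phi> j t)"
        by (rule gimt_regular[OF G(1) M0])+
      show "N \<le> NN j" "NN j > 0" using G(2) NNc by linarith+
    qed
    let ?X = "inv (\<phi> k)"
    let ?I = "{b - T..b + T}"
    define A where "A = (\<lambda>j t. of_real (\<alpha> j (?X t) / \<alpha> k (?X t) * w ((t - b) / T)) * cis (- (2 * pi * a * t)))"
    define \<theta> where "\<theta> = (\<lambda>j t. 2 * pi * NN j * \<phi> j (?X t))"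
    define S where "S = (\<lambda>j. integral ?I (\<lambda>t. A j t * s j (\<theta> j t)))"
    have cX: "continuous_on S ?X" for S
      using DERIV_isCont[OF inv_phase_has_deriv[OF reg(2,3)[OF k] M0]]
      by (intro continuous_at_imp_continuous_on) blast
    have c\<phi>: "continuous_on S (\<lambda>t. \<phi> j (?X t))" and c\<alpha>: "continuous_on S (\<lambda>t. \<alpha> j (?X t))"
      if "j \<in> {1..K}" for j S
      using reg(1,2)[OF that] unfolding tame_def
      by (auto intro!: continuous_on_compose2[OF smooth_continuous[of _ UNIV] cX])
    have \<alpha>0: "\<alpha> k t \<noteq> 0" for t by (rule tame_nonzero[OF reg(1)[OF k] M0])
    have cA: "continuous_on S (A j)" and c\<theta>: "continuous_on S (\<theta> j)" if "j \<in> {1..K}" for j S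
      unfolding A_def \<theta>_def using \<alpha>0
      by (intro continuous_intros c\<alpha> c\<phi> that k w; simp)+
    have cs: "continuous_on S (\<lambda>t. s j (\<theta> j t))" if "j \<in> {1..K}" for j S
      using continuous_on_compose2[OF shape_continuous[OF reg(4)[OF that], of UNIV] c\<theta>[OF that]] by simp
    have hk: "warped f (\<alpha> k) (\<phi> k) t = (\<Sum>j=1..K. of_real (\<alpha> j (?X t) / \<alpha> k (?X t)) * s j (\<theta> j t))" for t
      unfolding warped_def f[rule_format] sum_divide_distrib \<theta>_def
      by (intro sum.cong) (auto simp: reg(5))
    have "continuous_on UNIV (warped f (\<alpha> k) (\<phi> k))"
      using warped_continuous[OF M0 f _ k] gimt by blast
    then have "stft w T (warped f (\<alpha> k) (\<phi> k)) a b = integral ?I (\<lambda>t.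
        warped f (\<alpha> k) (\<phi> k) t * of_real (w ((t - b) / T)) * cis (- (2 * pi * a * t)))"
      by (rule stft_eq_integral[OF w T])
    also have "\<dots> = integral ?I (\<lambda>t. \<Sum>j=1..K. A j t * s j (\<theta> j t))"
      unfolding hk A_def sum_distrib_right
      by (intro arg_cong[of _ _ "integral ?I"] ext sum.cong) (simp_all add: mult_ac)
    also have "\<dots> = (\<Sum>j=1..K. S j)"
      unfolding S_def
      by (intro integral_sum integrable_continuous_real continuous_on_mult cA cs) auto
    also have "\<dots> = S k + (\<Sum>j\<in>{1..K} - {k}. S j)"
      using k by (subst sum.remove[of _ k]) auto
    finally have stft: "stft w T (warped f (\<alpha> k) (\<phi> k)) a b = S k + (\<Sum>j\<in>{1..K} - {k}. S j)" .

    \<comment> \<open>Cross terms: every harmonic has \<open>|n N\<^sub>j| \<ge> N\<close>, beyond the threshold of the oscillatory bound.\<close>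
    have "cmod (S j) \<le> M * \<kappa>" if j: "j \<in> {1..K}" "j \<noteq> k" for j
    proof -
      have "cmod (integral ?I (\<lambda>t. A j t * s j (\<theta> j t))
          - fourier_coeff (s j) 0 * integral ?I (\<lambda>t. A j t * cis (of_int 0 * \<theta> j t))) \<le> M * \<kappa>"
      proof (rule shape_integral_bound[OF reg(4)[OF j(1)] cA[OF j(1)] c\<theta>[OF j(1)]])
        fix n :: int assume n: "n \<noteq> 0"
        have "\<forall>a\<in>{1 / (2 * M\<^sup>2)<..<2 * M\<^sup>2}. \<forall>N>N\<^sub>1 T.
          measure lebesgue ({t. \<bar>\<bar>deriv (\<phi> j \<circ> ?X) t\<bar> - a\<bar> \<le> 1 / N powr (1 - \<eta>\<^sub>0 T)} \<inter> ?I)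
            \<le> C T * (1 / N powr \<eta>\<^sub>1 T)"
          using wd T k j unfolding well_different_def by blast
        moreover have "\<bar>of_int n * NN j\<bar> > Nc"
        proof -
          have "1 * NN j \<le> \<bar>of_int n\<bar> * NN j"
            using n reg(7)[OF j(1)] by (intro mult_right_mono) auto
          moreover have "\<bar>of_int n * NN j\<bar> = \<bar>of_int n\<bar> * NN j"
            using reg(7)[OF j(1)] by (simp add: abs_mult)
          ultimately show ?thesis using reg(6)[OF j(1)] NNc(1) by linarith
        qed
        ultimately have "cmod (integral ?I (\<lambda>t. of_real (\<alpha> j (?X t) / \<alpha> k (?X t) * w ((t - b) / T))
            * cis (2 * pi * (of_int n * NN j * \<phi> j (?X t) - a * t)))) \<le> \<kappa>"
          by (intro cross reg(1-3)[OF j(1)] reg(1-3)[OF k])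
        moreover have "A j t * cis (of_int n * \<theta> j t) = of_real (\<alpha> j (?X t) / \<alpha> k (?X t) * w ((t - b) / T))
            * cis (2 * pi * (of_int n * NN j * \<phi> j (?X t) - a * t))" for t
        proof -
          have "cis (- (2 * pi * a * t)) * cis (of_int n * \<theta> j t)
              = cis (2 * pi * (of_int n * NN j * \<phi> j (?X t) - a * t))"
            unfolding cis_mult \<theta>_def by (rule arg_cong[of _ _ cis]) (simp add: algebra_simps)
          then show ?thesis unfolding A_def by (simp only: mult.assoc)
        qed
        ultimately show "cmod (integral ?I (\<lambda>t. A j t * cis (of_int n * \<theta> j t))) \<le> \<kappa>"
          by (simp only:)
      qed (use \<kappa> in auto)
      moreover have "fourier_coeff (s j) 0 = 0"
        using reg(4)[OF j(1)] unfolding shape_functions_def by blast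
      ultimately show ?thesis unfolding S_def by simp
    qed
    then have "cmod (\<Sum>j\<in>{1..K} - {k}. S j) \<le> real (card ({1..K} - {k})) * (M * \<kappa>)"
      by (intro order.trans[OF norm_sum] sum_bounded_above) auto
    also have "\<dots> \<le> real K * (M * \<kappa>)"
      using M0 \<kappa> k by (intro mult_right_mono) auto
    finally have off: "cmod (\<Sum>j\<in>{1..K} - {k}. S j) \<le> e / 2" using \<kappa>e by linarith

    \<comment> \<open>In the diagonal term the warp has straightened the phase and the amplitude quotient is 1.\<close>
    have harm: "cmod (integral ?I (\<lambda>t. A k t * cis (of_int n * \<theta> k t)))
        = T * cmod (fourier_transform w (T * (a - of_int n * NN k)))" for n
    proof -
      have "A k t * cis (of_int n * \<theta> k t)
          = of_real (w ((t - b) / T)) * cis (2 * pi * (of_int n * NN k - a) * t)" for t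
      proof -
        have "\<phi> k (?X t) = t"
          using phase_bij[OF reg(2,3)[OF k] M0] by (simp add: bij_is_surj surj_f_inv_f)
        then have "cis (- (2 * pi * a * t)) * cis (of_int n * \<theta> k t)
            = cis (2 * pi * (of_int n * NN k - a) * t)"
          unfolding cis_mult \<theta>_def by (intro arg_cong[of _ _ cis]) (simp add: algebra_simps)
        then show ?thesis unfolding A_def using \<alpha>0 by (simp add: mult.assoc)
      qed
      then show ?thesis
        using windowed_exponential_integral[OF w T, of b "of_int n * NN k" a] by (simp only:)
    qed
    have "cmod (integral ?I (\<lambda>t. A k t * s k (\<theta> k t))
        - fourier_coeff (s k) l * integral ?I (\<lambda>t. A k t * cis (of_int l * \<theta> k t)))
        \<le> M * (2 * B / NN k)"
    proof (rule shape_integral_bound[OF reg(4)[OF k] cA[OF k] c\<theta>[OF k]])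
      fix n assume n: "n \<noteq> l"
      \<comment> \<open>The frequency a lies at least half a spacing away from every harmonic but the one at l.\<close>
      have "1 * NN k \<le> \<bar>of_int (l - n)\<bar> * NN k"
        using n reg(7)[OF k] by (intro mult_right_mono) auto
      also have "\<dots> = \<bar>of_int l * NN k - of_int n * NN k\<bar>"
        using reg(7)[OF k] by (simp add: abs_mult left_diff_distrib[symmetric])
      finally have far: "NN k / 2 \<le> \<bar>a - of_int n * NN k\<bar>" using a by linarith
      define x where "x = a - of_int n * NN k"
      have x: "\<bar>x\<bar> > 0" "NN k / 2 \<le> \<bar>x\<bar>" using far reg(7)[OF k] unfolding x_def by linarith+
      have "\<bar>x\<bar> * (T * cmod (fourier_transform w (T * x))) \<le> B"
        using B[of "T * x"] T by (simp add: abs_mult mult_ac)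
      then have "T * cmod (fourier_transform w (T * x)) \<le> B / \<bar>x\<bar>"
        using x by (simp add: field_simps)
      also have "\<dots> \<le> B / (NN k / 2)"
        using x B0 reg(7)[OF k] by (intro divide_left_mono) auto
      finally show "cmod (integral ?I (\<lambda>t. A k t * cis (of_int n * \<theta> k t))) \<le> 2 * B / NN k"
        unfolding harm x_def by (simp add: mult.commute)
    qed (use B0 reg(7)[OF k] in auto)
    also have "M * (2 * B / NN k) \<le> e / 2"
    proof -
      have "4 * M * B \<le> e * NN k"
        using NNc(2) reg(6)[OF k] e
        by (smt (verit) mult.commute mult_left_mono pos_divide_less_eq)
      then show ?thesis using reg(7)[OF k] by (simp add: field_simps)
    qed
    finally have diag: "cmod (S k - fourier_coeff (s k) l * integral ?I (\<lambda>t. A k t * cis (of_int l * \<theta> k t)))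
        \<le> e / 2" unfolding S_def .
    have tri: "\<bar>cmod (x + y) - cmod z\<bar> \<le> cmod (x - z) + cmod y" for x y z :: complex
      using norm_triangle_ineq3[of "x + y" z] norm_triangle_ineq[of "x - z" y]
      by (simp add: algebra_simps)
    show "\<bar>cmod (stft w T (warped f (\<alpha> k) (\<phi> k)) a b)
          - cmod (fourier_coeff (s k) l) * (T * cmod (fourier_transform w (T * (a - of_int l * NN k))))\<bar> \<le> e"
      using tri[of "S k" "\<Sum>j\<in>{1..K} - {k}. S j"
          "fourier_coeff (s k) l * integral ?I (\<lambda>t. A k t * cis (of_int l * \<theta> k t))"] diag off
      unfolding stft norm_mult harm by linarith
  qed
qed

theorem theorem4p5:
  fixes w :: "real \<Rightarrow> real" and M b s\<^sub>0 :: real and K :: nat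
  assumes "window w" and "M > 0" and "K > 0"
  shows "\<exists>T\<^sub>0 :: real \<Rightarrow> real. \<forall>\<eta>\<^sub>0 \<eta>\<^sub>1 N\<^sub>1 C :: real \<Rightarrow> real. \<exists>N\<^sub>0 :: real \<Rightarrow> real.
    \<forall>\<delta>>0. \<forall>T. T > 1 \<and> T > T\<^sub>0 \<delta> \<longrightarrow> N\<^sub>0 T > 0 \<and> (\<forall>N>N\<^sub>0 T.
      \<forall>(f :: real \<Rightarrow> complex) (g :: nat \<Rightarrow> real \<Rightarrow> complex) (\<alpha> :: nat \<Rightarrow> real \<Rightarrow> real)
        (s :: nat \<Rightarrow> real \<Rightarrow> complex) (\<phi> :: nat \<Rightarrow> real \<Rightarrow> real) (NN :: nat \<Rightarrow> real)
        (h :: nat \<Rightarrow> real \<Rightarrow> complex).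
        (\<forall>t. f t = (\<Sum>k=1..K. g k t)) \<and>
        (\<forall>k\<in>{1..K}. is_gimt M (NN k) (\<alpha> k) (s k) (\<phi> k) (g k) \<and> N \<le> NN k) \<and>
        well_different \<eta>\<^sub>0 \<eta>\<^sub>1 N\<^sub>1 C M K \<phi> b \<and>
        is_max_coeff K s s\<^sub>0 \<and>
        (\<forall>k\<in>{1..K}. h k = warped f (\<alpha> k) (\<phi> k))
        \<longrightarrow> (\<exists>a\<^sub>0 k\<^sub>0. stft_solution w T b K h (a\<^sub>0, k\<^sub>0)) \<and>
            (\<forall>a\<^sub>0 k\<^sub>0. stft_solution w T b K h (a\<^sub>0, k\<^sub>0) \<longrightarrow>
               (\<exists>n. fourier_coeff (s k\<^sub>0) n \<noteq> 0 \<and> \<bar>a\<^sub>0 - of_int n * NN k\<^sub>0\<bar> < \<delta>)))"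
proof -
  note w = assms(1) and M0 = assms(2) and K = assms(3)
  define W where "W = cmod (fourier_transform w 0)"
  have "cmod (fourier_transform w 1) < W" using w unfolding window_def W_def by simp
  then have W: "W > 0" using norm_ge_zero[of "fourier_transform w 1"] by linarith
  obtain B where B: "\<And>\<xi>. \<bar>\<xi>\<bar> * cmod (fourier_transform w \<xi>) \<le> B"
    using w unfolding window_def by (metis power_one_right)
  define T\<^sub>0 where "T\<^sub>0 = (\<lambda>\<delta>. 2 * B / (W * \<delta>))"
  show ?thesis
  proof (rule exI[of _ T\<^sub>0], intro allI)
    fix \<eta>\<^sub>0 \<eta>\<^sub>1 N\<^sub>1 C :: "real \<Rightarrow> real"
    \<comment> \<open>If \<open>T > 1\<close> and another condition fails, no signal satisfies the hypotheses, and any threshold will do.\<close>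
    define admissible where "admissible = (\<lambda>T. M \<ge> 1 \<and> T > 1 \<and> \<eta>\<^sub>1 T > 0 \<and> s\<^sub>0 > 0)"
    let ?P = "\<lambda>T n. (\<forall>N f g \<alpha> s \<phi> NN k l a.
      N > n \<longrightarrow> (\<forall>t. f t = (\<Sum>k=1..K. g k t)) \<longrightarrow>
      (\<forall>k\<in>{1..K}. is_gimt M (NN k) (\<alpha> k) (s k) (\<phi> k) (g k) \<and> N \<le> NN k) \<longrightarrow>
      well_different \<eta>\<^sub>0 \<eta>\<^sub>1 N\<^sub>1 C M K \<phi> b \<longrightarrow> k \<in> {1..K} \<longrightarrow> \<bar>a - of_int l * NN k\<bar> \<le> NN k / 2 \<longrightarrow>
      \<bar>cmod (stft w T (warped f (\<alpha> k) (\<phi> k)) a b)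
          - cmod (fourier_coeff (s k) l) * (T * cmod (fourier_transform w (T * (a - of_int l * NN k))))\<bar>
        \<le> T * s\<^sub>0 * W / 8)"
    have ex: "\<exists>n>0. ?P T n" if "admissible T" for T
    proof -
      have T: "M \<ge> 1" "T > 0" "\<eta>\<^sub>1 T > 0" "T * s\<^sub>0 * W / 8 > 0"
        using that W unfolding admissible_def by auto
      show ?thesis
        by (rule stft_near_single_harmonic[where \<eta>\<^sub>0 = \<eta>\<^sub>0 and \<eta>\<^sub>1 = \<eta>\<^sub>1 and N\<^sub>1 = N\<^sub>1 and C = C
              and K = K and b = b, OF w T B]) blast
    qed
    have "\<forall>T. \<exists>n. n > 0 \<and> (admissible T \<longrightarrow> ?P T n)"
    proof
      fix T show "\<exists>n. n > 0 \<and> (admissible T \<longrightarrow> ?P T n)"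
        using ex[of T] by (cases "admissible T") (blast, auto intro: exI[of _ 1])
    qed
    from choice[OF this] obtain N\<^sub>0 where N\<^sub>0_all: "\<forall>T. N\<^sub>0 T > 0 \<and> (admissible T \<longrightarrow> ?P T (N\<^sub>0 T))"
      by (rule exE)
    have N\<^sub>0_pos: "N\<^sub>0 T > 0" for T by (rule conjunct1[OF spec[OF N\<^sub>0_all]])
    have N\<^sub>0: "?P T (N\<^sub>0 T)" if "admissible T" for T
      by (rule mp[OF conjunct2[OF spec[OF N\<^sub>0_all]] that])
    have main: "(\<exists>a\<^sub>0 k\<^sub>0. stft_solution w T b K h (a\<^sub>0, k\<^sub>0)) \<and>
            (\<forall>a\<^sub>0 k\<^sub>0. stft_solution w T b K h (a\<^sub>0, k\<^sub>0) \<longrightarrow>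
               (\<exists>n. fourier_coeff (s k\<^sub>0) n \<noteq> 0 \<and> \<bar>a\<^sub>0 - of_int n * NN k\<^sub>0\<bar> < \<delta>))"
      if \<delta>: "\<delta> > 0" and T: "T > 1" "T > T\<^sub>0 \<delta>" and N: "N > N\<^sub>0 T"
        and f: "\<forall>t. f t = (\<Sum>k=1..K. g k t)"
        and gimt: "\<forall>k\<in>{1..K}. is_gimt M (NN k) (\<alpha> k) (s k) (\<phi> k) (g k) \<and> N \<le> NN k"
        and wd: "well_different \<eta>\<^sub>0 \<eta>\<^sub>1 N\<^sub>1 C M K \<phi> b"
        and max: "is_max_coeff K s s\<^sub>0"
        and h: "\<forall>k\<in>{1..K}. h k = warped f (\<alpha> k) (\<phi> k)"
      for \<delta> T N f g \<alpha> s \<phi> NN h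
    proof -
      have K1: "1 \<in> {1..K}" using K by simp
      note reg1 = gimt_regular[OF conjunct1[OF gimt[rule_format, OF K1]] M0]
      obtain n\<^sub>1 where "fourier_coeff (s 1) n\<^sub>1 \<noteq> 0" using shape_nonzero_coeff[OF reg1(4)] by blast
      then have "0 < cmod (fourier_coeff (s 1) n\<^sub>1)" by simp
      also have "\<dots> \<le> s\<^sub>0" using max K1 unfolding is_max_coeff_def by blast
      finally have s0: "s\<^sub>0 > 0" .
      have coeff_le: "cmod (fourier_coeff (s k) n) \<le> s\<^sub>0" if "k \<in> {1..K}" for k n
        using max that unfolding is_max_coeff_def by blast
      have "\<eta>\<^sub>1 T > 0"
        using wd[unfolded well_different_def, THEN conjunct2, THEN spec, of T] T(1) by linarith
      then have adm: "admissible T" unfolding admissible_def using s0 T reg1(5) by simp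
      have NN: "NN k > 0" if "k \<in> {1..K}" for k
        using gimt that N N\<^sub>0_pos[of T] by force
      define F where "F = (\<lambda>k a. cmod (stft w T (h k) a b))"
      define E where "E = T * s\<^sub>0 * W"
      have E: "E > 0" unfolding E_def using T s0 W by simp
      have near: "\<bar>F k a - cmod (fourier_coeff (s k) l)
          * (T * cmod (fourier_transform w (T * (a - of_int l * NN k))))\<bar> \<le> E / 8"
        if "k \<in> {1..K}" "\<bar>a - of_int l * NN k\<bar> \<le> NN k / 2" for k a l
        using N\<^sub>0[OF adm, rule_format, OF N f[rule_format] gimt[rule_format] wd that]
          h that(1) unfolding F_def E_def by simp
      have sol: "stft_solution w T b K h (a, k) \<longleftrightarrow> k \<in> {1..K} \<and> (\<forall>x. \<forall>j\<in>{1..K}. F j x \<le> F k a)"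
        for a k
        unfolding stft_solution_def is_arg_max_def F_def by (auto simp: not_less)

      have "\<forall>k\<in>{1..K}. \<exists>a. \<forall>x. F k x \<le> F k a"
      proof
        fix k assume k: "k \<in> {1..K}"
        have "continuous_on UNIV (h k)"
        proof -
          have "\<forall>k\<in>{1..K}. is_gimt M (NN k) (\<alpha> k) (s k) (\<phi> k) (g k)" using gimt by blast
          from warped_continuous[OF M0 f this k] show ?thesis by (simp only: h[rule_format, OF k])
        qed
        then show "\<exists>a. \<forall>x. F k x \<le> F k a"
          unfolding F_def using T by (intro stft_attains_max w) auto
      qed
      then obtain A where A: "\<And>k x. k \<in> {1..K} \<Longrightarrow> F k x \<le> F k (A k)" by metis
      have "Max ((\<lambda>k. F k (A k)) ` {1..K}) \<in> (\<lambda>k. F k (A k)) ` {1..K}"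
        using K1 by (intro Max_in) auto
      then obtain k\<^sub>2 where k2: "k\<^sub>2 \<in> {1..K}" "Max ((\<lambda>k. F k (A k)) ` {1..K}) = F k\<^sub>2 (A k\<^sub>2)" by auto
      have "F j x \<le> F k\<^sub>2 (A k\<^sub>2)" if "j \<in> {1..K}" for j x
      proof -
        have "F j (A j) \<le> F k\<^sub>2 (A k\<^sub>2)"
          unfolding k2(2)[symmetric] using that by (intro Max_ge) auto
        then show ?thesis using A[OF that, of x] by linarith
      qed
      then have "stft_solution w T b K h (A k\<^sub>2, k\<^sub>2)" using sol k2(1) by blast
      moreover have "\<exists>n. fourier_coeff (s k) n \<noteq> 0 \<and> \<bar>a - of_int n * NN k\<bar> < \<delta>"
        if "stft_solution w T b K h (a, k)" for a k
      proof (rule ccontr)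
        assume "\<not> ?thesis"
        then have far: "\<bar>a - of_int n * NN k\<bar> \<ge> \<delta>" if "fourier_coeff (s k) n \<noteq> 0" for n
          using that by (metis not_le)
        have k: "k \<in> {1..K}" and best: "\<And>x j. j \<in> {1..K} \<Longrightarrow> F j x \<le> F k a"
          using that unfolding sol by auto
        obtain j n where j: "j \<in> {1..K}" and n: "cmod (fourier_coeff (s j) n) = s\<^sub>0"
          using max unfolding is_max_coeff_def by blast
        have "\<bar>F j (of_int n * NN j) - s\<^sub>0 * (T * W)\<bar> \<le> E / 8"
          using near[OF j, of "of_int n * NN j" n] NN[OF j] n unfolding W_def by simp
        moreover have "s\<^sub>0 * (T * W) = E" unfolding E_def by simp
        ultimately have lower: "7 / 8 * E \<le> F k a" using best[OF j, of "of_int n * NN j"] by linarith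

        \<comment> \<open>The harmonic nearest to the maximiser, whether active or not.\<close>
        define l where "l = round (a / NN k)"
        define x where "x = a - of_int l * NN k"
        have "\<bar>of_int l - a / NN k\<bar> * NN k \<le> 1 / 2 * NN k"
          unfolding l_def using NN[OF k] by (intro mult_right_mono of_int_round_abs_le) auto
        also have "\<bar>of_int l - a / NN k\<bar> * NN k = \<bar>(of_int l - a / NN k) * NN k\<bar>"
          using NN[OF k] by (simp add: abs_mult)
        also have "(of_int l - a / NN k) * NN k = - x"
          unfolding x_def using NN[OF k] by (simp add: field_simps)
        finally have x: "\<bar>x\<bar> \<le> NN k / 2" by simp
        have "cmod (fourier_coeff (s k) l) * (T * cmod (fourier_transform w (T * x))) \<le> E / 2"
        proof (cases "fourier_coeff (s k) l = 0")
          case False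
          then have "\<bar>x\<bar> \<ge> \<delta>" using far unfolding x_def by blast
          then have "\<delta> * (T * cmod (fourier_transform w (T * x)))
              \<le> \<bar>x\<bar> * (T * cmod (fourier_transform w (T * x)))"
            using T by (intro mult_right_mono) auto
          also have "\<dots> \<le> B" using B[of "T * x"] T by (simp add: abs_mult mult_ac)
          also have "\<dots> \<le> \<delta> * (T * W / 2)"
            using T(2) \<delta> W unfolding T\<^sub>0_def by (simp add: field_simps)
          finally have "T * cmod (fourier_transform w (T * x)) \<le> T * W / 2"
            using \<delta> by simp
          then have "cmod (fourier_coeff (s k) l) * (T * cmod (fourier_transform w (T * x)))
              \<le> s\<^sub>0 * (T * W / 2)"
            using coeff_le[OF k] s0 T by (intro mult_mono) auto
          then show ?thesis unfolding E_def by (simp add: mult_ac)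
        qed (use E in simp)
        then have "F k a \<le> 5 / 8 * E"
          using near[OF k x[unfolded x_def]] unfolding x_def by linarith
        then show False using lower E by linarith
      qed
      ultimately show ?thesis by blast
    qed
    show "\<exists>N\<^sub>0. \<forall>\<delta>>0. \<forall>T. T > 1 \<and> T > T\<^sub>0 \<delta> \<longrightarrow> N\<^sub>0 T > 0 \<and> (\<forall>N>N\<^sub>0 T.
      \<forall>(f :: real \<Rightarrow> complex) (g :: nat \<Rightarrow> real \<Rightarrow> complex) (\<alpha> :: nat \<Rightarrow> real \<Rightarrow> real)
        (s :: nat \<Rightarrow> real \<Rightarrow> complex) (\<phi> :: nat \<Rightarrow> real \<Rightarrow> real) (NN :: nat \<Rightarrow> real)
        (h :: nat \<Rightarrow> real \<Rightarrow> complex).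
        (\<forall>t. f t = (\<Sum>k=1..K. g k t)) \<and>
        (\<forall>k\<in>{1..K}. is_gimt M (NN k) (\<alpha> k) (s k) (\<phi> k) (g k) \<and> N \<le> NN k) \<and>
        well_different \<eta>\<^sub>0 \<eta>\<^sub>1 N\<^sub>1 C M K \<phi> b \<and>
        is_max_coeff K s s\<^sub>0 \<and>
        (\<forall>k\<in>{1..K}. h k = warped f (\<alpha> k) (\<phi> k))
        \<longrightarrow> (\<exists>a\<^sub>0 k\<^sub>0. stft_solution w T b K h (a\<^sub>0, k\<^sub>0)) \<and>
            (\<forall>a\<^sub>0 k\<^sub>0. stft_solution w T b K h (a\<^sub>0, k\<^sub>0) \<longrightarrow>
               (\<exists>n. fourier_coeff (s k\<^sub>0) n \<noteq> 0 \<and> \<bar>a\<^sub>0 - of_int n * NN k\<^sub>0\<bar> < \<delta>)))"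
    proof (rule exI[of _ N\<^sub>0], intro allI impI, elim conjE, intro conjI[OF N\<^sub>0_pos] allI impI, elim conjE)
    qed (rule main)
  qed
qed

end
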